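(* Let $F$ be a field. Every countable dimensional Jacobson radical associative $F$-algebra is embeddable in a finitely generated Jacobson radical associative $F$-algebra.
   Context: Algebras are associative over the field $F$ and are not assumed to have an identity. An algebra $A$ is Jacobson radical if it equals its own Jacobson radical (equivalently, every element of $A$ is quasi-regular). Countable dimensional means countable dimensional as an $F$-vector space. "Embeddable" means that there is an injective homomorphism of $F$-algebras (not required to preserve identities). *)

theory Defs
  imports "Jordan_Normal_Form.Missing_VectorSpace" "HOL-Algebra.AbelCoset" "HOL-Library.Countable_Set"
begin

text \<open>
  Associative algebras over a field, not assumed to have an identity. They are carried by the
  \<open>module\<close> records of HOL-Algebra; the \<open>one\<close> field of such a record is never referred to and
  may hold any value.
\<close>

locale assoc_algebra = vectorspace F A for F and A (structure) +
  assumes mult_closed: "\<lbrakk>x \<in> carrier A; y \<in> carrier A\<rbrakk> \<Longrightarrow> x \<otimes> y \<in> carrier A"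
    and mult_assoc: "\<lbrakk>x \<in> carrier A; y \<in> carrier A; z \<in> carrier A\<rbrakk>
      \<Longrightarrow> (x \<otimes> y) \<otimes> z = x \<otimes> (y \<otimes> z)"
    and mult_add_left: "\<lbrakk>x \<in> carrier A; y \<in> carrier A; z \<in> carrier A\<rbrakk>
      \<Longrightarrow> (x \<oplus> y) \<otimes> z = x \<otimes> z \<oplus> y \<otimes> z"
    and mult_add_right: "\<lbrakk>x \<in> carrier A; y \<in> carrier A; z \<in> carrier A\<rbrakk>
      \<Longrightarrow> z \<otimes> (x \<oplus> y) = z \<otimes> x \<oplus> z \<otimes> y"
    and mult_smult_left: "\<lbrakk>c \<in> carrier F; x \<in> carrier A; y \<in> carrier A\<rbrakk>
      \<Longrightarrow> (c \<odot> x) \<otimes> y = c \<odot> (x \<otimes> y)"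
    and mult_smult_right: "\<lbrakk>c \<in> carrier F; x \<in> carrier A; y \<in> carrier A\<rbrakk>
      \<Longrightarrow> x \<otimes> (c \<odot> y) = c \<odot> (x \<otimes> y)"

text \<open>At most countable, so the finite-dimensional case is included.\<close>

definition countable_dimensional ::
    "('f, 'm) ring_scheme \<Rightarrow> ('f, 'a, 'n) module_scheme \<Rightarrow> bool" where
  "countable_dimensional F A \<longleftrightarrow> (\<exists>S. countable S \<and> vectorspace.basis F A S)"

definition assoc_subalgebra ::
    "('f, 'm) ring_scheme \<Rightarrow> 'a set \<Rightarrow> ('f, 'a, 'n) module_scheme \<Rightarrow> bool" where
  "assoc_subalgebra F T A \<longleftrightarrow> subspace F T A \<and> (\<forall>x\<in>T. \<forall>y\<in>T. x \<otimes>\<^bsub>A\<^esub> y \<in> T)"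

definition generated_subalgebra ::
    "('f, 'm) ring_scheme \<Rightarrow> ('f, 'a, 'n) module_scheme \<Rightarrow> 'a set \<Rightarrow> 'a set" where
  "generated_subalgebra F A S = \<Inter> {T. assoc_subalgebra F T A \<and> S \<subseteq> T}"

text \<open>
  A finitely generated algebra over \<open>F\<close> has at most countable dimension. Coordinates with respect to
  a basis therefore give an isomorphic copy carried by a subset of \<open>nat \<Rightarrow> 'f\<close>, so that asking
  for a finitely generated algebra on this type is no restriction.
\<close>

definition finitely_generated_algebra ::
    "('f, 'm) ring_scheme \<Rightarrow> ('f, 'a, 'n) module_scheme \<Rightarrow> bool" where
  "finitely_generated_algebra F A \<longleftrightarrow>
     (\<exists>S. finite S \<and> S \<subseteq> carrier A \<and> generated_subalgebra F A S = carrier A)"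

definition algebra_hom ::
    "('f, 'm) ring_scheme \<Rightarrow> ('f, 'a, 'n) module_scheme \<Rightarrow> ('f, 'b, 'k) module_scheme
      \<Rightarrow> ('a \<Rightarrow> 'b) set" where
  "algebra_hom F A B = module_hom F A B \<inter> hom A B"

text \<open>
  The Jacobson radical of a ring without identity is the intersection of its modular (also called
  regular) maximal right ideals, and the whole ring if there are none. A right ideal \<open>I\<close> is modular
  if some \<open>e\<close> is a left identity modulo \<open>I\<close>. Modular maximal right ideals of an algebra are
  automatically subspaces, so the radical of the algebra is that of its underlying ring.
\<close>

definition right_ideal :: "('a, 'm) ring_scheme \<Rightarrow> 'a set \<Rightarrow> bool" where
  "right_ideal A I \<longleftrightarrow>
     additive_subgroup I A \<and> (\<forall>x\<in>I. \<forall>a\<in>carrier A. x \<otimes>\<^bsub>A\<^esub> a \<in> I)"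

definition modular_right_ideal :: "('a, 'm) ring_scheme \<Rightarrow> 'a set \<Rightarrow> bool" where
  "modular_right_ideal A I \<longleftrightarrow> right_ideal A I \<and>
     (\<exists>e\<in>carrier A. \<forall>x\<in>carrier A. x \<ominus>\<^bsub>A\<^esub> e \<otimes>\<^bsub>A\<^esub> x \<in> I)"

definition maximal_right_ideal :: "('a, 'm) ring_scheme \<Rightarrow> 'a set \<Rightarrow> bool" where
  "maximal_right_ideal A I \<longleftrightarrow> right_ideal A I \<and> I \<noteq> carrier A \<and>
     (\<forall>J. right_ideal A J \<and> I \<subseteq> J \<longrightarrow> J = I \<or> J = carrier A)"

definition jacobson_radical :: "('a, 'm) ring_scheme \<Rightarrow> 'a set" where
  "jacobson_radical A =
     {x \<in> carrier A. \<forall>I. modular_right_ideal A I \<and> maximal_right_ideal A I \<longrightarrow> x \<in> I}"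

definition is_jacobson_radical :: "('a, 'm) ring_scheme \<Rightarrow> bool" where
  "is_jacobson_radical A \<longleftrightarrow> jacobson_radical A = carrier A"

definition quasi_regular :: "('a, 'm) ring_scheme \<Rightarrow> 'a \<Rightarrow> bool" where
  "quasi_regular A x \<longleftrightarrow> (\<exists>y\<in>carrier A.
     x \<oplus>\<^bsub>A\<^esub> y \<ominus>\<^bsub>A\<^esub> x \<otimes>\<^bsub>A\<^esub> y = \<zero>\<^bsub>A\<^esub> \<and> x \<oplus>\<^bsub>A\<^esub> y \<ominus>\<^bsub>A\<^esub> y \<otimes>\<^bsub>A\<^esub> x = \<zero>\<^bsub>A\<^esub>)"

context assoc_algebra
begin

lemma mult_zero [simp]:
  assumes "x \<in> carrier A"
  shows "\<zero> \<otimes> x = \<zero>" "x \<otimes> \<zero> = \<zero>"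
  using mult_smult_left[of "\<zero>\<^bsub>F\<^esub>" \<zero> x] mult_smult_right[of "\<zero>\<^bsub>F\<^esub>" x \<zero>] assms mult_closed
  by auto

lemma mult_minus:
  assumes "x \<in> carrier A" "y \<in> carrier A"
  shows "(\<ominus> x) \<otimes> y = \<ominus> (x \<otimes> y)" "x \<otimes> (\<ominus> y) = \<ominus> (x \<otimes> y)"
proof -
  have "(\<ominus> x) \<otimes> y \<oplus> x \<otimes> y = \<zero>"
    using assms mult_add_left[of "\<ominus> x" x y] by (simp add: M.l_neg)
  moreover have "x \<otimes> (\<ominus> y) \<oplus> x \<otimes> y = \<zero>"
    using assms mult_add_right[of "\<ominus> y" y x] by (simp add: M.l_neg)
  ultimately show "(\<ominus> x) \<otimes> y = \<ominus> (x \<otimes> y)" "x \<otimes> (\<ominus> y) = \<ominus> (x \<otimes> y)"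
    using assms by (auto intro!: M.minus_equality[symmetric] mult_closed)
qed

lemma circle_assoc:
  assumes "x \<in> carrier A" "y \<in> carrier A" "z \<in> carrier A"
  shows "(x \<oplus> y \<ominus> x \<otimes> y) \<oplus> z \<ominus> (x \<oplus> y \<ominus> x \<otimes> y) \<otimes> z
    = x \<oplus> (y \<oplus> z \<ominus> y \<otimes> z) \<ominus> x \<otimes> (y \<oplus> z \<ominus> y \<otimes> z)"
  using assms
  by (simp add: M.minus_eq mult_closed mult_add_left mult_add_right mult_minus mult_assoc
      M.minus_add M.a_ac)

lemma right_quasi_regular:
  assumes "is_jacobson_radical A" and a: "a \<in> carrier A"
  shows "\<exists>y\<in>carrier A. a \<oplus> y \<ominus> a \<otimes> y = \<zero>"
proof -
  define I where "I = {x \<ominus> a \<otimes> x | x. x \<in> carrier A}"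
  have I: "right_ideal A I"
    unfolding right_ideal_def
  proof (intro conjI ballI)
    show "additive_subgroup I A"
    proof (intro additive_subgroup.intro M.add.subgroupI)
      show "I \<subseteq> carrier A" using a by (auto simp: I_def mult_closed)
      show "I \<noteq> {}" by (auto simp: I_def)
    next
      fix u assume "u \<in> I"
      then obtain x where x: "x \<in> carrier A" "u = x \<ominus> a \<otimes> x" by (auto simp: I_def)
      have "\<ominus> u = (\<ominus> x) \<ominus> a \<otimes> (\<ominus> x)"
        using x a by (simp add: M.minus_eq mult_minus mult_closed M.minus_add)
      then show "\<ominus> u \<in> I" using x unfolding I_def by auto
    next
      fix u v assume "u \<in> I" "v \<in> I"
      then obtain x y where x: "x \<in> carrier A" "u = x \<ominus> a \<otimes> x" "y \<in> carrier A" "v = y \<ominus> a \<otimes> y"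
        by (auto simp: I_def)
      have "u \<oplus> v = (x \<oplus> y) \<ominus> a \<otimes> (x \<oplus> y)"
        using x a by (simp add: M.minus_eq mult_add_right mult_closed M.minus_add M.a_ac)
      then show "u \<oplus> v \<in> I" using x unfolding I_def by auto
    qed
  next
    fix u b assume "u \<in> I" and b: "b \<in> carrier A"
    then obtain x where x: "x \<in> carrier A" "u = x \<ominus> a \<otimes> x" by (auto simp: I_def)
    have "u \<otimes> b = (x \<otimes> b) \<ominus> a \<otimes> (x \<otimes> b)"
      using x a b by (simp add: M.minus_eq mult_minus mult_closed mult_add_left mult_assoc)
    then show "u \<otimes> b \<in> I" using x b unfolding I_def by (auto intro: mult_closed)
  qed
  have "a \<in> I"
  proof (rule ccontr)
    assume aI: "a \<notin> I"
    define S where "S = {J. right_ideal A J \<and> I \<subseteq> J \<and> a \<notin> J}"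
    have "\<exists>M\<in>S. \<forall>X\<in>S. M \<subseteq> X \<longrightarrow> X = M"
    proof (rule subset_Zorn_nonempty)
      show "S \<noteq> {}" using I aI by (auto simp: S_def)
    next
      fix C assume C: "C \<noteq> {}" "subset.chain S C"
      have CS: "right_ideal A J" "I \<subseteq> J" "a \<notin> J" if "J \<in> C" for J
        using C that by (auto simp: S_def subset.chain_def)
      have sub: "additive_subgroup J A" if "J \<in> C" for J
        using CS(1)[OF that] by (simp add: right_ideal_def)
      have "subgroup (\<Union> C) (add_monoid A)"
      proof (rule M.add.subgroupI)
        show "\<Union> C \<subseteq> carrier A" using additive_subgroup.a_subset[OF sub] by (simp add: Sup_le_iff)
        obtain J where "J \<in> C" using C(1) by auto
        then show "\<Union> C \<noteq> {}" using additive_subgroup.zero_closed[OF sub] by auto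
        show "\<ominus> u \<in> \<Union> C" if u: "u \<in> \<Union> C" for u
        proof -
          from u obtain J where "J \<in> C" "u \<in> J" by auto
          then show ?thesis using additive_subgroup.a_inv_closed[OF sub] by auto
        qed
        show "u \<oplus> v \<in> \<Union> C" if u: "u \<in> \<Union> C" and v: "v \<in> \<Union> C" for u v
        proof -
          obtain J K where JK: "J \<in> C" "K \<in> C" "u \<in> J" "v \<in> K" using u v by auto
          then consider "J \<subseteq> K" | "K \<subseteq> J" using C(2) by (auto simp: subset.chain_def)
          then obtain L where "L \<in> C" "u \<in> L" "v \<in> L"
            using JK by (metis subsetD)
          then show ?thesis using additive_subgroup.a_closed[OF sub] by auto
        qed
      qed
      moreover have "\<forall>x\<in>\<Union> C. \<forall>b\<in>carrier A. x \<otimes> b \<in> \<Union> C"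
        using CS(1) by (auto simp: right_ideal_def)
      ultimately have "right_ideal A (\<Union> C)"
        by (simp add: right_ideal_def additive_subgroup_def)
      moreover have "I \<subseteq> \<Union> C" "a \<notin> \<Union> C" using C(1) CS(2,3) by auto
      ultimately show "\<Union> C \<in> S" by (simp add: S_def)
    qed
    then obtain M where M: "M \<in> S" "\<And>X. X \<in> S \<Longrightarrow> M \<subseteq> X \<Longrightarrow> X = M" by blast
    have id: "right_ideal A M" and IM: "I \<subseteq> M" and aM: "a \<notin> M" using M(1) by (auto simp: S_def)
    have "modular_right_ideal A M"
      using id IM a unfolding modular_right_ideal_def I_def by blast
    moreover have "maximal_right_ideal A M"
      unfolding maximal_right_ideal_def
    proof (intro conjI allI impI)
      show "right_ideal A M" by (fact id)
      show "M \<noteq> carrier A" using aM a by auto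
      fix J assume J: "right_ideal A J \<and> M \<subseteq> J"
      show "J = M \<or> J = carrier A"
      proof (cases "a \<in> J")
        case False
        then show ?thesis using J M(2)[of J] IM by (auto simp: S_def)
      next
        case True
        have sg: "additive_subgroup J A" using J by (simp add: right_ideal_def)
        have "x \<in> J" if x: "x \<in> carrier A" for x
        proof -
          have "x \<ominus> a \<otimes> x \<in> J" using x J IM by (auto simp: I_def)
          moreover have "a \<otimes> x \<in> J" using True J x by (auto simp: right_ideal_def)
          ultimately have "(x \<ominus> a \<otimes> x) \<oplus> a \<otimes> x \<in> J"
            using additive_subgroup.a_closed[OF sg] by blast
          moreover have "(x \<ominus> a \<otimes> x) \<oplus> a \<otimes> x = x"
            using x a by (simp add: M.minus_eq M.a_assoc mult_closed M.l_neg)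
          ultimately show ?thesis by simp
        qed
        then show ?thesis using additive_subgroup.a_subset[OF sg] by auto
      qed
    qed
    ultimately have "a \<in> M"
      using assms unfolding is_jacobson_radical_def jacobson_radical_def by blast
    with aM show False by simp
  qed
  then obtain x where x: "x \<in> carrier A" "a = x \<ominus> a \<otimes> x" by (auto simp: I_def)
  have "a \<oplus> (\<ominus> x) \<ominus> a \<otimes> (\<ominus> x) = a \<ominus> (x \<ominus> a \<otimes> x)"
    using x(1) a by (simp add: M.minus_eq mult_minus mult_closed M.minus_add M.a_assoc)
  also have "\<dots> = \<zero>" using x(2) a by (metis M.minus_eq M.r_neg)
  finally show ?thesis using x(1) by blast
qed

theorem is_jacobson_radical_iff_quasi_regular:
  "is_jacobson_radical A \<longleftrightarrow> (\<forall>x\<in>carrier A. quasi_regular A x)"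
proof
  assume J: "is_jacobson_radical A"
  show "\<forall>x\<in>carrier A. quasi_regular A x"
  proof
    fix x assume x: "x \<in> carrier A"
    obtain y where y: "y \<in> carrier A" "x \<oplus> y \<ominus> x \<otimes> y = \<zero>"
      using right_quasi_regular[OF J x] by blast
    obtain z where z: "z \<in> carrier A" "y \<oplus> z \<ominus> y \<otimes> z = \<zero>"
      using right_quasi_regular[OF J y(1)] by blast
    have "z = x"
      using circle_assoc[OF x y(1) z(1)] x y z by (simp add: M.minus_eq)
    then show "quasi_regular A x"
      using x y z M.a_comm unfolding quasi_regular_def by (metis y z)
  qed
next
  assume Q: "\<forall>x\<in>carrier A. quasi_regular A x"
  have False if mod: "modular_right_ideal A I" and "maximal_right_ideal A I" for I
  proof -
    have id: "right_ideal A I" and ne: "I \<noteq> carrier A" using that by (auto simp: maximal_right_ideal_def)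
    have sg: "additive_subgroup I A" using id by (simp add: right_ideal_def)
    obtain e where e: "e \<in> carrier A" "\<And>x. x \<in> carrier A \<Longrightarrow> x \<ominus> e \<otimes> x \<in> I"
      using mod by (auto simp: modular_right_ideal_def)
    obtain y where y: "y \<in> carrier A" "e \<oplus> y \<ominus> e \<otimes> y = \<zero>"
      using Q e(1) by (auto simp: quasi_regular_def)
    have "e \<oplus> (y \<ominus> e \<otimes> y) = \<zero>" using e(1) y by (simp add: M.minus_eq M.a_assoc mult_closed)
    then have "e = \<ominus> (y \<ominus> e \<otimes> y)"
      using e(1) y(1) by (intro M.minus_equality[symmetric]) (auto intro: mult_closed)
    then have eI: "e \<in> I" using e(2)[OF y(1)] additive_subgroup.a_inv_closed[OF sg] M.abelian_group_axioms by metis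
    have "x \<in> I" if x: "x \<in> carrier A" for x
    proof -
      have "(x \<ominus> e \<otimes> x) \<oplus> e \<otimes> x \<in> I"
        using additive_subgroup.a_closed[OF sg e(2)[OF x]] id eI x by (auto simp: right_ideal_def)
      moreover have "(x \<ominus> e \<otimes> x) \<oplus> e \<otimes> x = x"
        using x e(1) by (simp add: M.minus_eq M.a_assoc mult_closed M.l_neg)
      ultimately show ?thesis by simp
    qed
    then show False using ne additive_subgroup.a_subset[OF sg] by auto
  qed
  then show "is_jacobson_radical A" by (auto simp: is_jacobson_radical_def jacobson_radical_def)
qed

end

end

theory Submission
  imports Defs "HOL-Real_Asymp.Real_Asymp"
begin

text \<open>
  Let \<open>U\<close> be the unitization of the radical algebra \<open>A\<close>. Suppose that finitely many letters generate
  a non-unital algebra \<open>N\<close> that is nil and infinite-dimensional, write \<open>N\<^sup>1\<close> for its unital hull, and let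
  \<open>\<gamma>\<close> be a linear map from \<open>N\<^sup>1\<close> to \<open>A\<close> that maps \<open>N\<close> onto \<open>A\<close>. On the right \<open>U\<close>-module
  \<open>U \<oplus> Hom(N\<^sup>1, U)\<close> there are the following operators: a letter \<open>x\<close> maps \<open>(u, \<phi>)\<close> to
  \<open>(0, w \<mapsto> \<phi> (w x))\<close>, the operator \<open>P\<close> maps it to \<open>(\<phi> 1, 0)\<close>, and \<open>Q\<close> maps it to
  \<open>(0, w \<mapsto> \<gamma> w \<cdot> u)\<close>. Let \<open>E\<close> be the algebra generated by the letters, \<open>P\<close> and \<open>Q\<close>. For \<open>w\<close> in \<open>N\<close>
  the product \<open>P w Q\<close> is left multiplication by \<open>\<gamma> w\<close> on the first summand. So \<open>E\<close> contains the operator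
  \<open>L a\<close> of left multiplication by any \<open>a\<close> in \<open>A\<close>, which embeds \<open>A\<close> into the finitely generated algebra
  \<open>E\<close>. This is a variant of the matrix wreath product of \<open>A\<close> and \<open>N\<close>. Being
  finitely generated, \<open>E\<close> is spanned by a countable set and has a copy in the space of sequences
  (\<open>finitely_generated_on_sequences\<close>).

  \<open>E\<close> is radical for three reasons. The identity \<open>L a r L b = L (a c b)\<close>, where \<open>c\<close> is an element of
  \<open>U\<close> that depends on \<open>r\<close>, reduces the invertibility of \<open>1 - L a r\<close> to quasi-regularity in \<open>A\<close>, so
  every \<open>L a\<close> lies in the radical of \<open>F 1 + E\<close> (\<open>L_radical\<close>). Next, \<open>P r P\<close> and \<open>Q r Q\<close> are
  multiples of operators \<open>L a\<close>, so \<open>P\<close> and \<open>Q\<close> lie in the radical too, which is a semiprime ideal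
  (\<open>P_radical\<close>, \<open>Q_radical\<close>). Hence every element of \<open>E\<close> is a nil combination of words in the letters
  plus an element of the radical (\<open>E_decomposition\<close>), and \<open>1 - x\<close> is invertible for all such \<open>x\<close>.

  The algebra \<open>N\<close> is a Golod--Shafarevich algebra on three letters. The field may be uncountable, so the
  elements of the free algebra cannot be treated one after the other. The relations demand instead,
  for each \<open>D\<close>, that a generic linear combination of the nonempty words of length at most \<open>D\<close> has vanishing
  power of some exponent \<open>nil_exponent D\<close>: each coefficient of that power, as a polynomial in the
  coefficients of the combination, is one relation. The number of these relations is polynomial in
  the exponent, while their degrees are at least the exponent, so a large exponent makes them sparse
  enough. Only linear maps on \<open>N\<^sup>1\<close> occur in the construction, and they are the functions on words that
  annihilate the relations. So neither the free algebra nor the ideal of relations is constructed, and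
  the inequality of Golod and Shafarevich is proved for the spaces of homogeneous functions of this
  kind: their dimension at least doubles from each degree to the next (\<open>golod_shafarevich_step\<close>,
  \<open>golod_shafarevich_growth\<close>).
\<close>

section \<open>Systems of linear equations in spaces of functions\<close>

definition function_space :: "('f, 'm) ring_scheme \<Rightarrow> ('w \<Rightarrow> 'f) set \<Rightarrow> bool" where
  "function_space F X \<longleftrightarrow> X \<subseteq> UNIV \<rightarrow> carrier F \<and>
     (\<forall>x\<in>X. \<forall>y\<in>X. (\<lambda>w. x w \<oplus>\<^bsub>F\<^esub> y w) \<in> X) \<and>
     (\<forall>c\<in>carrier F. \<forall>x\<in>X. (\<lambda>w. c \<otimes>\<^bsub>F\<^esub> x w) \<in> X)"

definition functional_on ::
    "('f, 'm) ring_scheme \<Rightarrow> ('w \<Rightarrow> 'f) set \<Rightarrow> (('w \<Rightarrow> 'f) \<Rightarrow> 'f) \<Rightarrow> bool" where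
  "functional_on F X g \<longleftrightarrow> g \<in> X \<rightarrow> carrier F \<and>
     (\<forall>x\<in>X. \<forall>y\<in>X. g (\<lambda>w. x w \<oplus>\<^bsub>F\<^esub> y w) = g x \<oplus>\<^bsub>F\<^esub> g y) \<and>
     (\<forall>c\<in>carrier F. \<forall>x\<in>X. g (\<lambda>w. c \<otimes>\<^bsub>F\<^esub> x w) = c \<otimes>\<^bsub>F\<^esub> g x)"

text \<open>
  If the evaluations at the points of \<open>W\<close> also separate \<open>X\<close>, then such a family is a basis, and the
  cardinality of \<open>W\<close> is the dimension of \<open>X\<close>; this is how dimensions are counted below.
\<close>

definition dual_family ::
    "('f, 'm) ring_scheme \<Rightarrow> ('w \<Rightarrow> 'f) set \<Rightarrow> 'w set \<Rightarrow> ('w \<Rightarrow> 'w \<Rightarrow> 'f) \<Rightarrow> bool" where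
  "dual_family F X W e \<longleftrightarrow>
     (\<forall>w\<in>W. e w \<in> X \<and> (\<forall>v\<in>W. e w v = (if v = w then \<one>\<^bsub>F\<^esub> else \<zero>\<^bsub>F\<^esub>)))"

context field
begin

lemma function_spaceD:
  assumes "function_space R X"
  shows "x \<in> X \<Longrightarrow> x w \<in> carrier R"
    and "x \<in> X \<Longrightarrow> y \<in> X \<Longrightarrow> (\<lambda>w. x w \<oplus> y w) \<in> X"
    and "c \<in> carrier R \<Longrightarrow> x \<in> X \<Longrightarrow> (\<lambda>w. c \<otimes> x w) \<in> X"
  using assms by (auto simp: function_space_def)

lemma functional_onD:
  assumes "functional_on R X g"
  shows "x \<in> X \<Longrightarrow> g x \<in> carrier R"
    and "x \<in> X \<Longrightarrow> y \<in> X \<Longrightarrow> g (\<lambda>w. x w \<oplus> y w) = g x \<oplus> g y"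
    and "c \<in> carrier R \<Longrightarrow> x \<in> X \<Longrightarrow> g (\<lambda>w. c \<otimes> x w) = c \<otimes> g x"
  using assms by (auto simp: functional_on_def)

text \<open>
  Fewer homogeneous equations than unknowns have a nontrivial solution. The unknowns are coordinates
  at the points of \<open>W\<close>, along which \<open>X\<close> has a dual family, and the equations are arbitrary functionals.
\<close>

lemma common_zero_of_functionals:
  assumes "finite L" "finite W" "card L < card W" "function_space R X"
    and "\<And>l. l \<in> L \<Longrightarrow> functional_on R X (g l)" "dual_family R X W e"
  shows "\<exists>x\<in>X. (\<exists>w\<in>W. x w \<noteq> \<zero>) \<and> (\<forall>l\<in>L. g l x = \<zero>)"
  using assms
proof (induction L arbitrary: X W e rule: finite_induct)
  case empty
  then obtain w where w: "w \<in> W" by fastforce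
  then have "e w \<in> X" "e w w \<noteq> \<zero>" using empty by (auto simp: dual_family_def)
  then show ?case using w by auto
next
  case (insert l L)
  note X = function_spaceD[OF insert.prems(3)]
  have gl: "functional_on R X (g l)" using insert.prems(4) by simp
  note G = functional_onD[OF gl]
  have eX: "e w \<in> X" if "w \<in> W" for w using insert.prems(5) that by (simp add: dual_family_def)
  define Y where "Y = {x \<in> X. g l x = \<zero>}"
  have Y: "function_space R Y"
    using X G by (auto simp: function_space_def Y_def)
  have gY: "functional_on R Y (g k)" if "k \<in> L" for k
    using insert.prems(4)[of k] that by (auto simp: functional_on_def Y_def)
  \<comment> \<open>Restricting to the kernel of one functional costs at most one evaluation point.\<close>
  have "\<exists>w0\<in>W. \<exists>e'. dual_family R Y (W - {w0}) e'"
  proof (cases "\<exists>w\<in>W. g l (e w) \<noteq> \<zero>")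
    case False
    obtain w0 where "w0 \<in> W" using insert.prems(2) by fastforce
    moreover have "dual_family R Y (W - {w0}) e"
      using False insert.prems(5) by (auto simp: dual_family_def Y_def)
    ultimately show ?thesis by blast
  next
    case True
    then obtain w0 where w0: "w0 \<in> W" "g l (e w0) \<noteq> \<zero>" by auto
    then have u: "g l (e w0) \<in> carrier R" "inv (g l (e w0)) \<in> carrier R"
      "inv (g l (e w0)) \<otimes> g l (e w0) = \<one>"
      using G(1)[OF eX[OF w0(1)]] Units_l_inv Units_inv_closed field_Units by auto
    define c where "c w = \<ominus> (g l (e w)) \<otimes> inv (g l (e w0))" for w
    have c: "c w \<in> carrier R" if "w \<in> W" for w
      using u G(1)[OF eX[OF that]] by (simp add: c_def)
    define e' where "e' w v = e w v \<oplus> c w \<otimes> e w0 v" for w v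
    have X': "(\<lambda>v. c w \<otimes> e w0 v) \<in> X" if "w \<in> W" for w
      using X(3)[OF c eX[OF w0(1)]] that by blast
    have "e' w \<in> Y" if w: "w \<in> W" for w
    proof -
      have "g l (e' w) = g l (e w) \<oplus> c w \<otimes> g l (e w0)"
        unfolding e'_def using G(2)[OF eX[OF w] X'[OF w]] G(3)[OF c[OF w] eX[OF w0(1)]] by simp
      also have "\<dots> = \<zero>"
        using u G(1)[OF eX[OF w]] by (simp add: c_def m_assoc r_neg l_minus)
      finally show ?thesis
        unfolding Y_def using X(2)[OF eX[OF w] X'[OF w]] by (simp add: e'_def[abs_def])
    qed
    moreover have "e' w v = (if v = w then \<one> else \<zero>)" if "w \<in> W - {w0}" "v \<in> W - {w0}" for w v
      using that insert.prems(5) w0(1) c[of w] by (auto simp: e'_def dual_family_def)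
    ultimately have "dual_family R Y (W - {w0}) e'" by (auto simp: dual_family_def)
    then show ?thesis using w0 by blast
  qed
  then obtain w0 e' where w0: "w0 \<in> W" and e': "dual_family R Y (W - {w0}) e'" by blast
  have "card L < card (W - {w0})"
    using insert.hyps insert.prems(1,2) w0 by simp
  from insert.IH[OF _ this Y gY e'] insert.prems(1)
  obtain x where "x \<in> Y" "\<exists>w\<in>W - {w0}. x w \<noteq> \<zero>" "\<forall>k\<in>L. g k x = \<zero>" by auto
  then show ?case by (auto simp: Y_def)
qed

text \<open>
  If \<open>V\<close> is minimal among the separating sets of points, then removing \<open>w\<close> leaves some nonzero function
  that vanishes on the rest of \<open>V\<close>; scaled, it is the member of the dual family at \<open>w\<close>.
\<close>

lemma minimal_separating_set_has_dual_family:
  assumes X: "function_space R X" and W: "finite W"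
    and sep: "\<And>x. x \<in> X \<Longrightarrow> \<forall>w\<in>W. x w = \<zero> \<Longrightarrow> x = (\<lambda>_. \<zero>)"
  obtains V e where "V \<subseteq> W" "\<And>x. x \<in> X \<Longrightarrow> \<forall>w\<in>V. x w = \<zero> \<Longrightarrow> x = (\<lambda>_. \<zero>)"
    "dual_family R X V e"
proof -
  let ?sep = "\<lambda>V. \<forall>x\<in>X. (\<forall>w\<in>V. x w = \<zero>) \<longrightarrow> x = (\<lambda>_. \<zero>)"
  have "finite {V. V \<subseteq> W \<and> ?sep V}" "W \<in> {V. V \<subseteq> W \<and> ?sep V}" using W sep by auto
  from finite_has_minimal2[OF this] obtain V where V: "V \<subseteq> W" "?sep V"
    and min: "\<And>V'. V' \<subseteq> V \<Longrightarrow> ?sep V' \<Longrightarrow> V' = V"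
    by (smt (verit) mem_Collect_eq order.trans)
  have "\<exists>y\<in>X. \<forall>v\<in>V. y v = (if v = w then \<one> else \<zero>)" if w: "w \<in> V" for w
  proof -
    have "\<not> ?sep (V - {w})" using min[of "V - {w}"] w by blast
    then obtain x where x: "x \<in> X" "\<forall>v\<in>V - {w}. x v = \<zero>" "x \<noteq> (\<lambda>_. \<zero>)" by auto
    then have nz: "x w \<noteq> \<zero>" using V(2) by blast
    note D = function_spaceD[OF X]
    have u: "x w \<in> carrier R" "inv (x w) \<in> carrier R" "inv (x w) \<otimes> x w = \<one>"
      using D(1)[OF x(1)] nz Units_l_inv Units_inv_closed field_Units by auto
    show ?thesis
      using D(3)[OF u(2) x(1)] x(2) u by (intro bexI[of _ "\<lambda>v. inv (x w) \<otimes> x v"]) auto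
  qed
  then obtain e where "\<forall>w\<in>V. e w \<in> X \<and> (\<forall>v\<in>V. e w v = (if v = w then \<one> else \<zero>))"
    by metis
  then show ?thesis using that[of V e] V unfolding dual_family_def by blast
qed

end

section \<open>Relations that force nilpotence\<close>

text \<open>
  Three letters leave room for the growth rate 2 of the dimensions after the relations are imposed.
\<close>

type_synonym letter = "bool option"

lemma card_letters: "card (UNIV :: letter set) = 3"
proof -
  have "(UNIV :: letter set) = {None, Some True, Some False}"
    by (auto simp: UNIV_option_conv UNIV_bool)
  then have "card (UNIV :: letter set) = card {None, Some True, Some False}" by (rule arg_cong)
  also have "\<dots> = 3" by simp
  finally show ?thesis .
qed

definition short_words :: "nat \<Rightarrow> letter list set" where
  "short_words D = {u. u \<noteq> [] \<and> length u \<le> D}"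

lemma finite_words_of_length [simp]: "finite {u :: letter list. length u = n}"
  using finite_lists_length_eq[OF finite_UNIV] by (simp only: subset_UNIV simp_thms)

lemma finite_short_words [simp]: "finite (short_words D)"
  using finite_lists_length_le[OF finite_UNIV, of D]
  by (rule finite_subset[rotated]) (auto simp: short_words_def)

lemma exponential_beats_power: "\<exists>n. (n + 1) ^ s * (c::nat) \<le> 2 ^ n"
proof -
  have "(\<lambda>n. real (Suc n) ^ s * (1/2) ^ Suc n) \<longlonglongrightarrow> 0"
    by real_asymp
  then have "\<forall>\<^sub>F n in sequentially. real (Suc n) ^ s * (1/2) ^ Suc n < 1 / (2 * (real c + 1))"
    by (rule order_tendstoD) simp
  then obtain n where "real (Suc n) ^ s * (1/2) ^ Suc n < 1 / (2 * (real c + 1))"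
    by (auto simp: eventually_sequentially)
  then have "real (Suc n) ^ s * (real c + 1) < 2 ^ n"
    by (simp add: field_simps)
  then have "real (Suc n ^ s * (c + 1)) < real (2 ^ n)" by (simp add: algebra_simps)
  then have "Suc n ^ s * (c + 1) < 2 ^ n" by (simp only: of_nat_less_iff)
  then show ?thesis by (intro exI[of _ n]) (simp add: algebra_simps)
qed

text \<open>
  With \<open>n\<close> this large the relations that belong to \<open>D\<close>, of which there are at most
  \<open>(n + 1) ^ card (short_words D)\<close>, have total weight at most \<open>1 / (4 \<cdot> 2 ^ D)\<close> if a relation of
  degree \<open>k\<close> is given the weight \<open>1 / 2 ^ k\<close>.
\<close>

definition nil_exponent :: "nat \<Rightarrow> nat" where
  "nil_exponent D = (SOME n. (n + 1) ^ card (short_words D) * (4 * 2 ^ D) \<le> 2 ^ n)"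

lemma nil_exponent:
  "(nil_exponent D + 1) ^ card (short_words D) * (4 * 2 ^ D) \<le> 2 ^ nil_exponent D"
  unfolding nil_exponent_def using exponential_beats_power by (rule someI_ex)

lemma nil_exponent_gt: "D < nil_exponent D"
proof -
  have "1 * (4 * 2 ^ D) \<le> (nil_exponent D + 1) ^ card (short_words D) * (4 * 2 ^ D)"
    by (intro mult_right_mono) simp_all
  also note nil_exponent
  finally have "2 ^ (D + 2) \<le> (2::nat) ^ nil_exponent D" by simp
  then show ?thesis by (subst (asm) power_increasing_iff) simp_all
qed

text \<open>
  A multiset \<open>m\<close> stands for the relation whose left-hand side is the sum of all concatenations of the
  members of \<open>m\<close>, in all orders. This is the coefficient at the monomial with exponents \<open>m\<close> in the power
  with exponent \<open>nil_exponent D\<close> of a generic linear combination of short words. It is homogeneous, and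
  its coefficients are integers, so that the same relations serve every field.
\<close>

definition relators :: "nat \<Rightarrow> letter list multiset set" where
  "relators D = {m. size m = nil_exponent D \<and> set_mset m \<subseteq> short_words D}"

definition weight :: "letter list multiset \<Rightarrow> nat" where
  "weight m = (\<Sum>u\<in>#m. length u)"

lemma length_concat_eq_weight: "mset us = m \<Longrightarrow> length (concat us) = weight m"
  by (auto simp: weight_def length_concat simp flip: sum_mset_sum_list)

lemma size_le_weight: "set_mset m \<subseteq> short_words D \<Longrightarrow> size m \<le> weight m"
proof (induction m)
  case (add u m)
  then have "size m \<le> weight m" and u: "u \<noteq> []" by (auto simp: short_words_def)
  moreover from u have "1 \<le> length u" by (simp add: Suc_le_eq)
  ultimately have "size m + 1 \<le> weight m + length u" by (intro add_le_mono)
  then show ?case by (simp add: weight_def)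
qed (simp add: weight_def)

lemma relators_weight: "m \<in> relators D \<Longrightarrow> nil_exponent D \<le> weight m"
  using size_le_weight[of m D] by (auto simp: relators_def)

text \<open>
  A relation is determined by its exponents, each of which is at most \<open>nil_exponent D\<close>. This gives the
  polynomial bound on the number of relations.
\<close>

lemma relators_inj_count:
  "inj_on (\<lambda>m. restrict (count m) (short_words D)) (relators D)"
proof (rule inj_onI)
  fix m m' assume "m \<in> relators D" "m' \<in> relators D"
    "restrict (count m) (short_words D) = restrict (count m') (short_words D)"
  then have eq: "restrict (count m) (short_words D) u = restrict (count m') (short_words D) u"
    and notin: "u \<notin> short_words D \<Longrightarrow> u \<notin># m \<and> u \<notin># m'" for u
    by (auto simp: relators_def)
  show "m = m'"
  proof (rule multiset_eqI)
    show "count m u = count m' u" for u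
      using eq[of u] notin[of u] by (cases "u \<in> short_words D") (simp_all add: not_in_iff)
  qed
qed

lemma relators_counts:
  "(\<lambda>m. restrict (count m) (short_words D)) ` relators D \<subseteq> short_words D \<rightarrow>\<^sub>E {..nil_exponent D}"
proof (intro image_subsetI PiE_I)
  show "restrict (count m) (short_words D) u \<in> {..nil_exponent D}"
    if "m \<in> relators D" "u \<in> short_words D" for m u
    using that count_le_size[of m u] by (simp add: relators_def)
qed simp

lemma finite_relators [simp]: "finite (relators D)"
  by (rule inj_on_finite[OF relators_inj_count relators_counts]) (simp add: finite_PiE)

lemma card_relators_le: "card (relators D) \<le> (nil_exponent D + 1) ^ card (short_words D)"
  using card_inj_on_le[OF relators_inj_count relators_counts] 
  by (simp add: finite_PiE card_PiE)

section \<open>The Golod--Shafarevich inequality\<close>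

text \<open>
  A function on words extends to a linear map on the free algebra. The condition says that this map
  vanishes on the two-sided ideal generated by the relations. The values may lie in any additive group,
  since they are scalars for the dimension count and elements of an algebra for the construction of
  operators.
\<close>

definition annihilates_relators :: "('c, 'd) ring_scheme \<Rightarrow> (letter list \<Rightarrow> 'c) \<Rightarrow> bool" where
  "annihilates_relators G \<phi> \<longleftrightarrow> (\<forall>D. \<forall>m\<in>relators D. \<forall>u v.
     (\<Oplus>\<^bsub>G\<^esub>us\<in>{us. mset us = m}. \<phi> (u @ concat us @ v)) = \<zero>\<^bsub>G\<^esub>)"

lemma finite_arrangements [simp]: "finite {us. mset us = m}"
proof -
  obtain vs where "mset vs = m" using ex_mset by blast
  then show ?thesis using mset_eq_finite[of vs] by simp
qed

context ring
begin

lemma finsum_zero_cong: "(\<And>i. i \<in> I \<Longrightarrow> f i = \<zero>) \<Longrightarrow> (\<Oplus>i\<in>I. f i) = \<zero>"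
  by (rule add.finprod_one_eqI)

lemma annihilates_relators_add:
  assumes "x \<in> UNIV \<rightarrow> carrier R" "y \<in> UNIV \<rightarrow> carrier R"
    and "annihilates_relators R x" "annihilates_relators R y"
  shows "annihilates_relators R (\<lambda>w. x w \<oplus> y w)"
  unfolding annihilates_relators_def
proof (intro allI ballI)
  fix D m u v assume "m \<in> relators D"
  then show "(\<Oplus>us\<in>{us. mset us = m}. x (u @ concat us @ v) \<oplus> y (u @ concat us @ v)) = \<zero>"
    using assms by (subst finsum_addf) (auto simp: annihilates_relators_def)
qed

lemma annihilates_relators_smult:
  assumes "x \<in> UNIV \<rightarrow> carrier R" "c \<in> carrier R" "annihilates_relators R x"
  shows "annihilates_relators R (\<lambda>w. c \<otimes> x w)"
  unfolding annihilates_relators_def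
proof (intro allI ballI)
  fix D m u v assume "m \<in> relators D"
  then show "(\<Oplus>us\<in>{us. mset us = m}. c \<otimes> x (u @ concat us @ v)) = \<zero>"
    using assms by (subst finsum_rdistr[symmetric]) (auto simp: annihilates_relators_def)
qed

lemma annihilates_relators_mult_right:
  assumes "x \<in> UNIV \<rightarrow> carrier R" "c \<in> carrier R" "annihilates_relators R x"
  shows "annihilates_relators R (\<lambda>w. x w \<otimes> c)"
  unfolding annihilates_relators_def
proof (intro allI ballI)
  fix D m u v assume "m \<in> relators D"
  then show "(\<Oplus>us\<in>{us. mset us = m}. x (u @ concat us @ v) \<otimes> c) = \<zero>"
    using assms by (subst finsum_ldistr[symmetric]) (auto simp: annihilates_relators_def)
qed

lemma annihilates_relators_zero: "annihilates_relators R (\<lambda>w. \<zero>)"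
  by (simp add: annihilates_relators_def)

lemma annihilates_relators_shift:
  "annihilates_relators R x \<Longrightarrow> annihilates_relators R (\<lambda>w. x (w @ z))"
  by (simp add: annihilates_relators_def)

end

context field
begin

text \<open>
  The dual space of the component of degree \<open>n\<close> of the algebra defined by the relations.
\<close>

definition homogeneous :: "nat \<Rightarrow> (letter list \<Rightarrow> 'a) set" where
  "homogeneous n = {\<phi> \<in> UNIV \<rightarrow> carrier R.
     (\<forall>w. length w \<noteq> n \<longrightarrow> \<phi> w = \<zero>) \<and> annihilates_relators R \<phi>}"

lemma function_space_homogeneous: "function_space R (homogeneous n)"
  unfolding function_space_def
proof (intro conjI ballI)
  show "homogeneous n \<subseteq> UNIV \<rightarrow> carrier R" by (auto simp: homogeneous_def)
  show "(\<lambda>w. x w \<oplus> y w) \<in> homogeneous n" if "x \<in> homogeneous n" "y \<in> homogeneous n" for x y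
    using that annihilates_relators_add[of x y] by (auto simp: homogeneous_def)
  show "(\<lambda>w. c \<otimes> x w) \<in> homogeneous n" if "c \<in> carrier R" "x \<in> homogeneous n" for c x
    using that annihilates_relators_smult[of x c] by (auto simp: homogeneous_def)
qed

lemma homogeneous_coordinates:
  obtains V e where "V \<subseteq> {w. length w = n}" "dual_family R (homogeneous n) V e"
    "\<And>x. x \<in> homogeneous n \<Longrightarrow> \<forall>w\<in>V. x w = \<zero> \<Longrightarrow> x = (\<lambda>_. \<zero>)"
proof (rule minimal_separating_set_has_dual_family[OF function_space_homogeneous[of n]])
  show "finite {w :: letter list. length w = n}" by simp
  show "x = (\<lambda>_. \<zero>)" if "x \<in> homogeneous n" "\<forall>w\<in>{w. length w = n}. x w = \<zero>" for x
  proof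
    show "x w = \<zero>" for w using that by (cases "length w = n") (simp_all add: homogeneous_def)
  qed
qed (rule that)

text \<open>
  For a function all of whose shifts by a letter annihilate the ideal, only the relations at the very
  end of a word remain to be checked. The defect of \<open>m\<close> at the end of a word, as a function of the rest
  of the word, itself annihilates the ideal, because a relation further left is followed by at least one
  letter. So this defect vanishes as soon as it vanishes at the coordinates of its degree.
\<close>

lemma relator_sum_homogeneous:
  assumes x: "x \<in> UNIV \<rightarrow> carrier R" "\<And>w. length w \<noteq> Suc n \<Longrightarrow> x w = \<zero>"
    and shift: "\<And>i. (\<lambda>w. x (w @ [i])) \<in> homogeneous n"
    and m: "m \<in> relators D" "weight m \<le> Suc n"
  shows "(\<lambda>u. \<Oplus>us\<in>{us. mset us = m}. x (u @ concat us)) \<in> homogeneous (Suc n - weight m)"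
proof -
  have wm: "weight m > 0" using relators_weight[OF m(1)] nil_exponent_gt[of D] by linarith
  have "annihilates_relators R (\<lambda>u. \<Oplus>us\<in>{us. mset us = m}. x (u @ concat us))"
    unfolding annihilates_relators_def
  proof (intro allI ballI)
    fix D' m' u v assume m': "m' \<in> relators D'"
    have "(\<Oplus>vs\<in>{vs. mset vs = m'}. \<Oplus>us\<in>{us. mset us = m}. x ((u @ concat vs @ v) @ concat us))
      = (\<Oplus>us\<in>{us. mset us = m}. \<Oplus>vs\<in>{vs. mset vs = m'}. x ((u @ concat vs @ v) @ concat us))"
      using x(1) by (intro finsum_finsum_swap) auto
    also have "\<dots> = \<zero>"
    proof (rule finsum_zero_cong)
      fix us assume "us \<in> {us. mset us = m}"
      then have "length (concat us) \<noteq> 0" using length_concat_eq_weight[of us m] wm by simp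
      then have "concat us \<noteq> []" by (metis list.size(3))
      then obtain z i where z: "concat us = z @ [i]" by (metis rev_exhaust)
      have "annihilates_relators R (\<lambda>w. x (w @ [i]))" using shift[of i] by (simp add: homogeneous_def)
      then have "(\<Oplus>vs\<in>{vs. mset vs = m'}. x ((u @ concat vs @ v @ z) @ [i])) = \<zero>"
        using m' unfolding annihilates_relators_def by blast
      then show "(\<Oplus>vs\<in>{vs. mset vs = m'}. x ((u @ concat vs @ v) @ concat us)) = \<zero>"
        by (simp add: z)
    qed
    finally show "(\<Oplus>vs\<in>{vs. mset vs = m'}. \<Oplus>us\<in>{us. mset us = m}.
      x ((u @ concat vs @ v) @ concat us)) = \<zero>" .
  qed
  moreover have "(\<Oplus>us\<in>{us. mset us = m}. x (w @ concat us)) = \<zero>"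
    if "length w \<noteq> Suc n - weight m" for w
    using that m(2) by (intro finsum_zero_cong x(2)) (auto simp: length_concat_eq_weight)
  moreover have "x w \<in> carrier R" for w using x(1) by blast
  ultimately show ?thesis by (simp add: homogeneous_def)
qed

text \<open>
  Functions of degree \<open>n + 1\<close> whose shifts by each letter annihilate the ideal are triples of functions in
  degree \<open>n\<close>; hence the factor 3. Such a function annihilates the ideal if the defects of the previous
  lemma vanish, which costs as many equations as the sum on the right counts. Were the inequality
  false, there would be a nonzero solution that satisfies these equations and also vanishes at all
  coordinates in degree \<open>n + 1\<close>.
\<close>

lemma golod_shafarevich_step:
  assumes V: "\<And>n. V n \<subseteq> {w. length w = n}"
    and e: "\<And>n. dual_family R (homogeneous n) (V n) (e n)"
    and sep: "\<And>n x. x \<in> homogeneous n \<Longrightarrow> \<forall>w\<in>V n. x w = \<zero> \<Longrightarrow> x = (\<lambda>_. \<zero>)"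
  shows "3 * card (V n) \<le> card (V (Suc n)) +
    (\<Sum>D\<le>Suc n. \<Sum>m\<in>{m \<in> relators D. weight m \<le> Suc n}. card (V (Suc n - weight m)))"
proof (rule ccontr)
  assume less: "\<not> ?thesis"
  have finV: "finite (V k)" for k by (rule finite_subset[OF V]) simp
  define I where "I = (SIGMA D:{..Suc n}. SIGMA m:{m \<in> relators D. weight m \<le> Suc n}.
    V (Suc n - weight m))"
  define L where "L = Inl ` V (Suc n) \<union> Inr ` I"
  define g where "g l x = (case l of Inl w \<Rightarrow> x w
    | Inr (D, m, u) \<Rightarrow> \<Oplus>us\<in>{us. mset us = m}. x (u @ concat us))"
    for l :: "letter list + nat \<times> letter list multiset \<times> letter list" and x
  define X where "X = {x \<in> UNIV \<rightarrow> carrier R. (\<forall>w. length w \<noteq> Suc n \<longrightarrow> x w = \<zero>) \<and>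
    (\<forall>i. (\<lambda>w. x (w @ [i])) \<in> homogeneous n)}"
  define W where "W = (\<lambda>(w, i). w @ [i]) ` (V n \<times> (UNIV :: letter set))"
  have I: "finite I" "card I = (\<Sum>D\<le>Suc n. \<Sum>m\<in>{m \<in> relators D. weight m \<le> Suc n}.
      card (V (Suc n - weight m)))"
    unfolding I_def using finV by (auto intro!: finite_SigmaI simp: card_SigmaI)
  have L: "finite L" "card L = card (V (Suc n)) + card I"
    unfolding L_def using finV[of "Suc n"] I(1)
    by (simp, subst card_Un_disjoint) (auto simp: card_image)
  have W: "finite W" "card W = 3 * card (V n)"
  proof -
    have "inj_on (\<lambda>(w, i). w @ [i]) (V n \<times> (UNIV :: letter set))"
      by (rule inj_onI) (simp split: prod.splits)
    then have "card W = card (V n \<times> (UNIV :: letter set))"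
      unfolding W_def by (rule card_image)
    then show "card W = 3 * card (V n)"
      by (simp only: card_cartesian_product card_letters mult.commute)
    show "finite W" unfolding W_def using finV[of n] by (intro finite_imageI finite_cartesian_product) auto
  qed
  have Xc: "x \<in> UNIV \<rightarrow> carrier R" if "x \<in> X" for x using that by (simp add: X_def)
  then have Xc': "x w \<in> carrier R" if "x \<in> X" for x w using that by blast
  have X: "function_space R X"
    unfolding function_space_def
  proof (intro conjI ballI)
    show "X \<subseteq> UNIV \<rightarrow> carrier R" using Xc by blast
    show "(\<lambda>w. x w \<oplus> y w) \<in> X" if "x \<in> X" "y \<in> X" for x y
      using that function_spaceD(2)[OF function_space_homogeneous[of n]] by (simp add: X_def Pi_iff)
    show "(\<lambda>w. c \<otimes> x w) \<in> X" if "c \<in> carrier R" "x \<in> X" for c x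
      using that function_spaceD(3)[OF function_space_homogeneous[of n]] by (simp add: X_def Pi_iff)
  qed
  have "\<exists>x\<in>X. (\<exists>w\<in>W. x w \<noteq> \<zero>) \<and> (\<forall>l\<in>L. g l x = \<zero>)"
  proof (rule common_zero_of_functionals[OF L(1) W(1) _ X])
    show "card L < card W" using less L(2) I(2) W(2) by linarith
    show "functional_on R X (g l)" if "l \<in> L" for l
    proof (cases l)
      case (Inl w)
      then show ?thesis using Xc' by (simp add: functional_on_def g_def)
    next
      case (Inr r)
      obtain D m u where r: "r = (D, m, u)" by (cases r) auto
      have "g l = (\<lambda>x. \<Oplus>us\<in>{us. mset us = m}. x (u @ concat us))"
        by (auto simp: g_def Inr r)
      moreover have "functional_on R X (\<lambda>x. \<Oplus>us\<in>{us. mset us = m}. x (u @ concat us))"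
        unfolding functional_on_def
      proof (intro conjI ballI)
        show "(\<Oplus>us\<in>{us. mset us = m}. x (u @ concat us) \<oplus> y (u @ concat us))
          = (\<Oplus>us\<in>{us. mset us = m}. x (u @ concat us)) \<oplus> (\<Oplus>us\<in>{us. mset us = m}. y (u @ concat us))"
          if "x \<in> X" "y \<in> X" for x y
          using that Xc' by (intro finsum_addf) auto
        show "(\<Oplus>us\<in>{us. mset us = m}. c \<otimes> x (u @ concat us))
          = c \<otimes> (\<Oplus>us\<in>{us. mset us = m}. x (u @ concat us))" if "c \<in> carrier R" "x \<in> X" for c x
          using that Xc' by (intro finsum_rdistr[symmetric]) auto
      qed (use Xc' in auto)
      ultimately show ?thesis by simp
    qed
    \<comment> \<open>Functions of degree \<open>n\<close> that are placed behind one last letter.\<close>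
    define e' where "e' x u = (if u \<noteq> [] \<and> last u = last x then e n (butlast x) (butlast u) else \<zero>)"
      for x u :: "letter list"
    have e'X: "e' (w @ [i]) \<in> X" if w: "w \<in> V n" for w i
    proof -
      have ew: "e n w \<in> homogeneous n" using e[of n] w by (simp add: dual_family_def)
      moreover have "(\<lambda>_. \<zero>) \<in> homogeneous n"
        by (auto simp: homogeneous_def annihilates_relators_def)
      moreover have "(\<lambda>v. e' (w @ [i]) (v @ [j])) = (if j = i then e n w else (\<lambda>_. \<zero>))" for j
        by (simp add: e'_def fun_eq_iff)
      ultimately have shift: "(\<lambda>v. e' (w @ [i]) (v @ [j])) \<in> homogeneous n" for j
        by simp
      have ec: "e n w v \<in> carrier R" "length v \<noteq> n \<Longrightarrow> e n w v = \<zero>" for v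
        using ew by (auto simp: homogeneous_def)
      have "e' (w @ [i]) v = \<zero>" if "length v \<noteq> Suc n" for v
        using that ec(2)[of "butlast v"] by (cases v rule: rev_cases) (simp_all add: e'_def)
      moreover have "e' (w @ [i]) v \<in> carrier R" for v
        using ec(1) by (simp add: e'_def)
      ultimately show ?thesis using shift by (simp add: X_def)
    qed
    show "dual_family R X W e'"
      using e[of n] e'X by (auto simp: dual_family_def W_def e'_def)
  qed
  then obtain x w where x: "x \<in> X" "\<forall>l\<in>L. g l x = \<zero>" "x w \<noteq> \<zero>" by blast
  have "annihilates_relators R x"
    unfolding annihilates_relators_def
  proof (intro allI ballI)
    fix D m u v assume m: "m \<in> relators D"
    show "(\<Oplus>us\<in>{us. mset us = m}. x (u @ concat us @ v)) = \<zero>"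
    proof (cases v rule: rev_cases)
      case (snoc z i)
      have "annihilates_relators R (\<lambda>w. x (w @ [i]))" using x(1) by (simp add: X_def homogeneous_def)
      then show ?thesis using m by (simp add: annihilates_relators_def snoc)
    next
      case Nil
      show ?thesis
      proof (cases "weight m \<le> Suc n")
        case False
        then show ?thesis
          using x(1) by (intro finsum_zero_cong) (auto simp: X_def length_concat_eq_weight)
      next
        case True
        have D: "D \<le> Suc n" using relators_weight[OF m] nil_exponent_gt[of D] True by linarith
        let ?y = "\<lambda>u. \<Oplus>us\<in>{us. mset us = m}. x (u @ concat us)"
        have "?y \<in> homogeneous (Suc n - weight m)"
          using x(1) m True by (intro relator_sum_homogeneous) (auto simp: X_def)
        moreover have "?y v = \<zero>" if "v \<in> V (Suc n - weight m)" for v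
        proof -
          have "Inr (D, m, v) \<in> L" using that m True D by (auto simp: L_def I_def)
          then have "g (Inr (D, m, v)) x = \<zero>" using x(2) by blast
          then show ?thesis by (simp add: g_def)
        qed
        ultimately have "?y = (\<lambda>_. \<zero>)" using sep by blast
        then show ?thesis using Nil by (simp add: fun_eq_iff)
      qed
    qed
  qed
  then have "x \<in> homogeneous (Suc n)" using x(1) by (auto simp: homogeneous_def X_def)
  moreover have "\<forall>w\<in>V (Suc n). x w = \<zero>"
  proof
    fix w assume "w \<in> V (Suc n)"
    then have "g (Inl w) x = \<zero>" using x(2) by (simp add: L_def)
    then show "x w = \<zero>" by (simp add: g_def)
  qed
  ultimately have "x = (\<lambda>_. \<zero>)" using sep by blast
  with x(3) show False by simp
qed

end

text \<open>
  If the sequence has doubled up to \<open>n\<close>, then \<open>a (n + 1 - k)\<close> is at most \<open>2 a n / 2 ^ k\<close>, and the choice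
  of the exponents bounds the double sum by \<open>a n\<close>. Of the three copies of \<open>a n\<close> two remain.
\<close>

lemma golod_shafarevich_growth:
  fixes a :: "nat \<Rightarrow> nat"
  assumes step: "\<And>n. 3 * a n \<le> a (Suc n) +
    (\<Sum>D\<le>Suc n. \<Sum>m\<in>{m \<in> relators D. weight m \<le> Suc n}. a (Suc n - weight m))"
  shows "2 * a n \<le> a (Suc n)"
proof (induction n rule: less_induct)
  case (less n)
  have halve: "a (n - j) * 2 ^ j \<le> a n" if "j \<le> n" for j
    using that
  proof (induction j)
    case (Suc j)
    have "a (n - Suc j) * 2 ^ Suc j = (2 * a (n - Suc j)) * 2 ^ j" by simp
    also have "\<dots> \<le> a (Suc (n - Suc j)) * 2 ^ j"
      using less.IH[of "n - Suc j"] Suc.prems by (intro mult_right_mono) auto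
    also have "Suc (n - Suc j) = n - j" using Suc.prems by simp
    finally have "a (n - Suc j) * 2 ^ Suc j \<le> a (n - j) * 2 ^ j" .
    also have "\<dots> \<le> a n" using Suc by simp
    finally show ?case .
  qed simp
  have inner: "(\<Sum>m\<in>{m \<in> relators D. weight m \<le> Suc n}. real (a (Suc n - weight m)))
      \<le> real (a n) / 2 * (1/2) ^ D" for D
  proof -
    have "real (a (Suc n - weight m)) \<le> real (a n) * 2 / 2 ^ nil_exponent D"
      if "m \<in> {m \<in> relators D. weight m \<le> Suc n}" for m
    proof -
      have m: "nil_exponent D \<le> weight m" "weight m \<le> Suc n" "1 \<le> weight m"
        using that relators_weight[of m D] nil_exponent_gt[of D] by auto
      have "a (Suc n - weight m) * 2 ^ nil_exponent D \<le> a (Suc n - weight m) * 2 ^ weight m"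
        using m by (intro mult_left_mono power_increasing) auto
      also have "\<dots> = 2 * (a (n - (weight m - 1)) * 2 ^ (weight m - 1))"
        using m by (cases "weight m") simp_all
      also have "\<dots> \<le> 2 * a n" using halve[of "weight m - 1"] m by (intro mult_left_mono) auto
      finally have "real (a (Suc n - weight m) * 2 ^ nil_exponent D) \<le> real (2 * a n)"
        by (simp only: of_nat_le_iff)
      then show ?thesis by (simp add: field_simps)
    qed
    then have "(\<Sum>m\<in>{m \<in> relators D. weight m \<le> Suc n}. real (a (Suc n - weight m)))
      \<le> real (card {m \<in> relators D. weight m \<le> Suc n}) * (real (a n) * 2 / 2 ^ nil_exponent D)"
      by (rule sum_bounded_above)
    also have "\<dots> \<le> real (card (relators D)) * (real (a n) * 2 / 2 ^ nil_exponent D)"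
      by (intro mult_right_mono) (auto intro!: card_mono)
    also have "\<dots> = real (a n) / 2 * (1/2) ^ D * (real (card (relators D) * (4 * 2 ^ D)) / 2 ^ nil_exponent D)"
      by (simp add: field_simps)
    also have "\<dots> \<le> real (a n) / 2 * (1/2) ^ D * 1"
    proof (intro mult_left_mono)
      have "card (relators D) * (4 * 2 ^ D) \<le> (nil_exponent D + 1) ^ card (short_words D) * (4 * 2 ^ D)"
        using card_relators_le[of D] by (intro mult_right_mono) auto
      also note nil_exponent
      finally have "real (card (relators D) * (4 * 2 ^ D)) \<le> real (2 ^ nil_exponent D)"
        by (simp only: of_nat_le_iff)
      then show "real (card (relators D) * (4 * 2 ^ D)) / 2 ^ nil_exponent D \<le> 1" by simp
    qed simp
    finally show ?thesis by simp
  qed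
  have "(\<Sum>D\<le>Suc n. \<Sum>m\<in>{m \<in> relators D. weight m \<le> Suc n}. real (a (Suc n - weight m)))
      \<le> (\<Sum>D\<le>Suc n. real (a n) / 2 * (1/2) ^ D)"
    by (intro sum_mono inner)
  also have "\<dots> = real (a n) / 2 * (\<Sum>D\<le>Suc n. (1/2) ^ D)"
    by (simp only: sum_distrib_left)
  also have "\<dots> \<le> real (a n) / 2 * 2"
  proof (intro mult_left_mono)
    have eq: "(\<Sum>D\<le>Suc n. (1/2 :: real) ^ D) = 2 - (1/2) ^ Suc n"
      by (induction n) (simp_all add: field_simps)
    show "(\<Sum>D\<le>Suc n. (1/2 :: real) ^ D) \<le> 2" unfolding eq by simp
  qed simp
  finally have "real (\<Sum>D\<le>Suc n. \<Sum>m\<in>{m \<in> relators D. weight m \<le> Suc n}. a (Suc n - weight m))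
      \<le> real (a n)"
    by simp
  then have "(\<Sum>D\<le>Suc n. \<Sum>m\<in>{m \<in> relators D. weight m \<le> Suc n}. a (Suc n - weight m)) \<le> a n"
    by (simp only: of_nat_le_iff)
  with step[of n] show ?case by linarith
qed

text \<open>
  The algebra defined by the relations is nonzero in every degree, hence infinite-dimensional.
\<close>

theorem (in field) exists_homogeneous_functional:
  "\<exists>\<psi>\<in>homogeneous n. \<exists>w. length w = n \<and> \<psi> w = \<one>"
proof -
  have "\<exists>V e. V \<subseteq> {w. length w = k} \<and> dual_family R (homogeneous k) V e \<and>
    (\<forall>x\<in>homogeneous k. (\<forall>w\<in>V. x w = \<zero>) \<longrightarrow> x = (\<lambda>_. \<zero>))" for k
    by (rule homogeneous_coordinates[of k]) blast
  then obtain V e where V: "\<And>k. V k \<subseteq> {w. length w = k}"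
    and e: "\<And>k. dual_family R (homogeneous k) (V k) (e k)"
    and sep: "\<And>k x. x \<in> homogeneous k \<Longrightarrow> \<forall>w\<in>V k. x w = \<zero> \<Longrightarrow> x = (\<lambda>_. \<zero>)"
    by metis
  have finV: "finite (V k)" for k by (rule finite_subset[OF V]) simp
  have "V 0 \<noteq> {}"
  proof
    assume empty: "V 0 = {}"
    let ?x = "\<lambda>w :: letter list. if w = [] then \<one> else \<zero>"
    have "annihilates_relators R ?x"
      unfolding annihilates_relators_def
    proof (intro allI ballI)
      fix D m u v assume m: "m \<in> relators D"
      have "0 < weight m" using relators_weight[OF m] nil_exponent_gt[of D] by linarith
      then have "\<not> (u @ concat us @ v = [])" if "us \<in> {us. mset us = m}" for us
        using that length_concat_eq_weight[of us m] by (metis (mono_tags) append_is_Nil_conv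
            list.size(3) mem_Collect_eq less_irrefl)
      then show "(\<Oplus>us\<in>{us. mset us = m}. ?x (u @ concat us @ v)) = \<zero>"
        by (intro finsum_zero_cong) (simp only: if_False)
    qed
    then have "?x \<in> homogeneous 0" by (auto simp: homogeneous_def)
    then have "?x = (\<lambda>_. \<zero>)" using sep[of ?x 0] empty by blast
    then have "\<one> = \<zero>" by (metis (full_types))
    then show False by simp
  qed
  then have "0 < card (V 0)" using finV by (simp add: card_gt_0_iff)
  moreover have "2 * card (V k) \<le> card (V (Suc k))" for k
    by (rule golod_shafarevich_growth) (rule golod_shafarevich_step[OF V e sep])
  ultimately have "0 < card (V n)"
  proof (induction n)
    case (Suc n)
    show ?case using Suc.prems(2)[of n] Suc.IH[OF Suc.prems(1) Suc.prems(2)] by linarith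
  qed
  then obtain w where "w \<in> V n" by (auto simp: card_gt_0_iff)
  then show ?thesis using e[of n] V[of n] by (intro bexI[of _ "e n w"] exI[of _ w]) (auto simp: dual_family_def)
qed

section \<open>The Jacobson radical of a unital ring\<close>

context ring
begin

lemmas nc_ring_simps = l_distr r_distr minus_eq l_minus r_minus minus_add m_assoc a_ac r_neg l_neg
  r_neg1 r_neg2

definition right_invertible :: "'a \<Rightarrow> bool" where
  "right_invertible x \<longleftrightarrow> (\<exists>y\<in>carrier R. x \<otimes> y = \<one>)"

text \<open>
  The Jacobson radical of a unital ring in its elementwise form. It is used for the unital hull of a
  non-unital algebra, where products with \<open>1 - x\<close> are easier to handle than the circle composition.
\<close>

definition unital_radical :: "'a set" where
  "unital_radical = {x \<in> carrier R. \<forall>r\<in>carrier R. right_invertible (\<one> \<ominus> x \<otimes> r)}"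

lemma right_invertible_left_factor:
  assumes "x \<in> carrier R" "y \<in> carrier R" "right_invertible (x \<otimes> y)"
  shows "right_invertible x"
  using assms m_assoc[of x y] by (metis m_closed right_invertible_def)

lemma unital_radicalD:
  "x \<in> unital_radical \<Longrightarrow> x \<in> carrier R"
  "x \<in> unital_radical \<Longrightarrow> r \<in> carrier R \<Longrightarrow> right_invertible (\<one> \<ominus> x \<otimes> r)"
  by (auto simp: unital_radical_def)

lemma unital_radical_right:
  "x \<in> unital_radical \<Longrightarrow> r \<in> carrier R \<Longrightarrow> x \<otimes> r \<in> unital_radical"
  by (auto simp: unital_radical_def m_assoc)

text \<open>
  If \<open>y\<close> is a right inverse of \<open>1 - b a\<close>, then \<open>1 + a y b\<close> is a right inverse of \<open>1 - a b\<close>. This is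
  what makes the radical a left ideal.
\<close>

lemma right_invertible_swap:
  assumes a: "a \<in> carrier R" and b: "b \<in> carrier R" and "right_invertible (\<one> \<ominus> b \<otimes> a)"
  shows "right_invertible (\<one> \<ominus> a \<otimes> b)"
proof -
  obtain y where y: "y \<in> carrier R" "(\<one> \<ominus> b \<otimes> a) \<otimes> y = \<one>"
    using assms by (auto simp: right_invertible_def)
  have "(\<one> \<ominus> a \<otimes> b) \<otimes> (\<one> \<oplus> a \<otimes> y \<otimes> b) = \<one> \<ominus> a \<otimes> b \<oplus> a \<otimes> ((\<one> \<ominus> b \<otimes> a) \<otimes> y) \<otimes> b"
    using a b y(1) by (simp add: nc_ring_simps)
  also have "\<dots> = \<one> \<ominus> a \<otimes> b \<oplus> a \<otimes> b" using a b by (simp add: y(2))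
  also have "\<dots> = \<one>" using a b by (simp add: minus_eq a_assoc l_neg)
  finally show ?thesis using a b y(1) unfolding right_invertible_def
    by (intro bexI[of _ "\<one> \<oplus> a \<otimes> y \<otimes> b"]) auto
qed

lemma unital_radical_left:
  assumes x: "x \<in> unital_radical" and r: "r \<in> carrier R"
  shows "r \<otimes> x \<in> unital_radical"
proof -
  have "right_invertible (\<one> \<ominus> r \<otimes> x \<otimes> s)" if s: "s \<in> carrier R" for s
  proof -
    note xc = unital_radicalD(1)[OF x]
    have "right_invertible (\<one> \<ominus> x \<otimes> (s \<otimes> r))"
      using r s by (intro unital_radicalD(2)[OF x]) simp
    then have "right_invertible (\<one> \<ominus> r \<otimes> (x \<otimes> s))"
      using xc r s by - (rule right_invertible_swap, simp_all add: m_assoc)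
    then show ?thesis using xc r s by (simp add: m_assoc)
  qed
  then show ?thesis using unital_radicalD(1)[OF x] r by (simp add: unital_radical_def)
qed

lemma unital_radical_add:
  assumes x: "x \<in> unital_radical" and y: "y \<in> unital_radical"
  shows "x \<oplus> y \<in> unital_radical"
proof -
  note D = unital_radicalD
  have "right_invertible (\<one> \<ominus> (x \<oplus> y) \<otimes> r)" if r: "r \<in> carrier R" for r
  proof -
    obtain u where u: "u \<in> carrier R" "(\<one> \<ominus> x \<otimes> r) \<otimes> u = \<one>"
      using D(2)[OF x r] by (auto simp: right_invertible_def)
    have "(\<one> \<ominus> (x \<oplus> y) \<otimes> r) \<otimes> u = (\<one> \<ominus> x \<otimes> r) \<otimes> u \<ominus> y \<otimes> (r \<otimes> u)"
      using D(1)[OF x] D(1)[OF y] r u(1) by (simp add: nc_ring_simps)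
    then have "right_invertible ((\<one> \<ominus> (x \<oplus> y) \<otimes> r) \<otimes> u)"
      using D(2)[OF y m_closed[OF r u(1)]] by (simp only: u(2))
    then show ?thesis
      using D(1)[OF x] D(1)[OF y] r u(1) by - (rule right_invertible_left_factor[of _ u], simp_all)
  qed
  then show ?thesis using D(1)[OF x] D(1)[OF y] by (simp add: unital_radical_def)
qed

lemma unital_radical_zero: "\<zero> \<in> unital_radical"
  by (simp add: unital_radical_def right_invertible_def minus_eq)

text \<open>
  \<open>1 - x\<close> is a left factor of \<open>1 - x ^ k\<close>.
\<close>

lemma right_invertible_of_power:
  assumes x: "x \<in> carrier R" and k: "x [^] (k::nat) \<in> unital_radical"
  shows "right_invertible (\<one> \<ominus> x)"
proof -
  have "\<exists>g\<in>carrier R. (\<one> \<ominus> x) \<otimes> g = \<one> \<ominus> x [^] n" for n :: nat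
  proof (induction n)
    case 0
    show ?case using x by (intro bexI[of _ \<zero>]) (auto simp: minus_eq r_neg)
  next
    case (Suc n)
    then obtain g where g: "g \<in> carrier R" "(\<one> \<ominus> x) \<otimes> g = \<one> \<ominus> x [^] n" by auto
    have xn: "x [^] n \<in> carrier R" using x by simp
    have c: "x [^] n \<otimes> x = x \<otimes> x [^] n" using x nat_pow_Suc2[OF x] by simp
    have "(\<one> \<ominus> x) \<otimes> (g \<oplus> x [^] n) = (\<one> \<ominus> x) \<otimes> g \<oplus> (x [^] n \<ominus> x \<otimes> x [^] n)"
      using x xn g(1) by (simp add: nc_ring_simps)
    also have "\<dots> = \<one> \<ominus> x [^] n \<oplus> (x [^] n \<ominus> x \<otimes> x [^] n)" by (simp only: g(2))
    also have "\<dots> = \<one> \<ominus> x \<otimes> x [^] n" using x xn by (simp add: nc_ring_simps)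
    finally show ?case using g(1) xn c by (intro bexI[of _ "g \<oplus> x [^] n"]) auto
  qed
  from this[of k] obtain g where g: "g \<in> carrier R" "(\<one> \<ominus> x) \<otimes> g = \<one> \<ominus> x [^] k" by auto
  have "right_invertible (\<one> \<ominus> x [^] k)"
    using unital_radicalD(2)[OF k one_closed] x by simp
  then show ?thesis using x g by - (rule right_invertible_left_factor[of _ g], simp_all)
qed

text \<open>
  The square of \<open>x r\<close> is \<open>(x r x) r\<close>, so it lies in the radical.
\<close>

lemma unital_radical_semiprime:
  assumes x: "x \<in> carrier R" and xrx: "\<And>r. r \<in> carrier R \<Longrightarrow> x \<otimes> r \<otimes> x \<in> unital_radical"
  shows "x \<in> unital_radical"
proof -
  have "right_invertible (\<one> \<ominus> x \<otimes> r)" if r: "r \<in> carrier R" for r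
  proof (rule right_invertible_of_power)
    have "(x \<otimes> r) [^] (2::nat) = x \<otimes> r \<otimes> x \<otimes> r"
      using x r by (simp add: numeral_2_eq_2 m_assoc)
    then show "(x \<otimes> r) [^] (2::nat) \<in> unital_radical"
      using unital_radical_right[OF xrx[OF r] r] by simp
  qed (use x r in simp)
  then show ?thesis using x by (simp add: unital_radical_def)
qed

text \<open>
  Modulo the radical, powers of \<open>b + j\<close> agree with powers of \<open>b\<close>.
\<close>

lemma right_invertible_nil_plus_radical:
  assumes b: "b \<in> carrier R" "b [^] (k::nat) = \<zero>" and j: "j \<in> unital_radical"
  shows "right_invertible (\<one> \<ominus> (b \<oplus> j))"
proof (rule right_invertible_of_power)
  have jc: "j \<in> carrier R" using unital_radicalD(1)[OF j] .
  show "b \<oplus> j \<in> carrier R" using b jc by simp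
  have "\<exists>i\<in>unital_radical. (b \<oplus> j) [^] n = b [^] n \<oplus> i" for n :: nat
  proof (induction n)
    case 0
    show ?case by (rule bexI[OF _ unital_radical_zero]) simp
  next
    case (Suc n)
    then obtain i where i: "i \<in> unital_radical" "(b \<oplus> j) [^] n = b [^] n \<oplus> i" by auto
    have ic: "i \<in> carrier R" and bn: "b [^] n \<in> carrier R"
      using unital_radicalD(1)[OF i(1)] b by auto
    have "(b \<oplus> j) [^] Suc n = (b [^] n \<oplus> i) \<otimes> (b \<oplus> j)" using i(2) by simp
    also have "\<dots> = b [^] n \<otimes> b \<oplus> (i \<otimes> (b \<oplus> j) \<oplus> b [^] n \<otimes> j)"
      using b(1) jc ic bn by (simp add: nc_ring_simps)
    finally show ?case
      using unital_radical_add[OF unital_radical_right[OF i(1)] unital_radical_left[OF j bn],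
          of "b \<oplus> j"] b(1) jc by (intro bexI[of _ "i \<otimes> (b \<oplus> j) \<oplus> b [^] n \<otimes> j"]) simp_all
  qed
  from this[of k] show "(b \<oplus> j) [^] k \<in> unital_radical"
    using b(2) unital_radicalD(1) by (metis l_zero)
qed

text \<open>
  The hypotheses describe \<open>k = L a r\<close>, \<open>l = L s\<close> and \<open>l' = L s'\<close> for elements with \<open>s + s' = s s'\<close>:
  up to the square-zero element \<open>n = k - l\<close>, which annihilates \<open>l\<close> from the left, \<open>k\<close> behaves
  like \<open>l\<close>. So \<open>1 - l'\<close>, a right inverse of \<open>1 - l\<close>, reduces \<open>1 - k\<close> to \<open>1 - n\<close>.
\<close>

lemma right_invertible_one_minus:
  assumes k: "k \<in> carrier R" and l: "l \<in> carrier R" "l' \<in> carrier R"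
    and kk: "k \<otimes> k = l \<otimes> k" and kl: "k \<otimes> l = l \<otimes> l" and kl': "k \<otimes> l' = l \<oplus> l'"
  shows "right_invertible (\<one> \<ominus> k)"
proof -
  define n where "n = k \<ominus> l"
  have n: "n \<in> carrier R" using k l by (simp add: n_def)
  have nk: "n \<otimes> k = \<zero>" and nl: "n \<otimes> l = \<zero>"
    using k l kk kl by (simp_all add: n_def l_distr l_minus minus_eq r_neg)
  have "n \<otimes> n = n \<otimes> k \<ominus> n \<otimes> l"
    unfolding n_def using k l by (simp add: r_distr r_minus minus_eq)
  then have nn: "n \<otimes> n = \<zero>" by (simp add: nk nl minus_eq)
  have "(\<one> \<ominus> k) \<otimes> (\<one> \<ominus> l') = \<one> \<ominus> k \<ominus> l' \<oplus> k \<otimes> l'"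
    using k l by (simp add: nc_ring_simps)
  also have "\<dots> = \<one> \<ominus> n"
    unfolding kl' n_def using k l by (simp add: nc_ring_simps)
  finally have 1: "(\<one> \<ominus> k) \<otimes> (\<one> \<ominus> l') = \<one> \<ominus> n" .
  have "(\<one> \<ominus> n) \<otimes> (\<one> \<oplus> n) = (\<one> \<oplus> n) \<ominus> n \<otimes> (\<one> \<oplus> n)"
    using n by (simp add: l_distr l_minus minus_eq)
  also have "\<dots> = \<one>" using n by (simp add: r_distr nn minus_eq a_assoc r_neg)
  finally have "(\<one> \<ominus> n) \<otimes> (\<one> \<oplus> n) = \<one>" .
  then have "right_invertible (\<one> \<ominus> n)" using n by (auto simp: right_invertible_def)
  then have "right_invertible ((\<one> \<ominus> k) \<otimes> (\<one> \<ominus> l'))" by (simp only: 1)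
  then show ?thesis using k l by - (rule right_invertible_left_factor[of _ "\<one> \<ominus> l'"], simp_all)
qed

end

section \<open>Subalgebras and finitely generated algebras\<close>

context assoc_algebra
begin

lemma submodule_criterion:
  assumes "T \<subseteq> carrier A" "\<zero> \<in> T" "\<And>x y. x \<in> T \<Longrightarrow> y \<in> T \<Longrightarrow> x \<oplus> y \<in> T"
    and "\<And>c x. c \<in> carrier F \<Longrightarrow> x \<in> T \<Longrightarrow> c \<odot> x \<in> T"
  shows "submodule F T A"
  using assms module_axioms by (simp add: submodule_def)

lemma assoc_subalgebraI:
  assumes "T \<subseteq> carrier A" "\<zero> \<in> T" "\<And>x y. x \<in> T \<Longrightarrow> y \<in> T \<Longrightarrow> x \<oplus> y \<in> T"
    and "\<And>c x. c \<in> carrier F \<Longrightarrow> x \<in> T \<Longrightarrow> c \<odot> x \<in> T"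
    and "\<And>x y. x \<in> T \<Longrightarrow> y \<in> T \<Longrightarrow> x \<otimes> y \<in> T"
  shows "assoc_subalgebra F T A"
  using submodule_criterion[OF assms(1-4)] assms(5) vectorspace_axioms
  by (simp add: assoc_subalgebra_def VectorSpace.subspace_def)

lemma assoc_subalgebraD:
  assumes "assoc_subalgebra F T A"
  shows "T \<subseteq> carrier A" "\<zero> \<in> T" "\<And>x y. x \<in> T \<Longrightarrow> y \<in> T \<Longrightarrow> x \<oplus> y \<in> T"
    and "\<And>c x. c \<in> carrier F \<Longrightarrow> x \<in> T \<Longrightarrow> c \<odot> x \<in> T"
    and "\<And>x y. x \<in> T \<Longrightarrow> y \<in> T \<Longrightarrow> x \<otimes> y \<in> T"
  using assms by (auto simp: assoc_subalgebra_def VectorSpace.subspace_def submodule_def)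

lemma assoc_subalgebra_carrier: "assoc_subalgebra F (carrier A) A"
  by (rule assoc_subalgebraI) (auto intro: mult_closed)

lemma assoc_subalgebra_algebra:
  assumes "assoc_subalgebra F T A"
  shows "assoc_algebra F (A\<lparr>carrier := T\<rparr>)"
proof -
  note T = assoc_subalgebraD[OF assms]
  have "vectorspace F (A\<lparr>carrier := T\<rparr>)"
    using assms by (intro subspace_is_vs) (simp add: assoc_subalgebra_def)
  then show ?thesis
    unfolding assoc_algebra_def assoc_algebra_axioms_def
    using T(1,5) mult_assoc mult_add_left mult_add_right mult_smult_left mult_smult_right
    by (auto simp: subset_iff)
qed

lemma unital_ring:
  assumes "\<one> \<in> carrier A" "\<And>x. x \<in> carrier A \<Longrightarrow> \<one> \<otimes> x = x" "\<And>x. x \<in> carrier A \<Longrightarrow> x \<otimes> \<one> = x"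
  shows "ring A"
proof (rule ringI)
  show "abelian_group A" by (rule M.abelian_group_axioms)
  show "monoid A" by (rule monoidI) (use assms in \<open>auto simp: mult_assoc mult_closed\<close>)
qed (auto simp: mult_add_left mult_add_right)

text \<open>
  Additive inverses depend on the carrier of the record through their definition, so their agreement has
  to be proved.
\<close>

lemma subalgebra_minus:
  assumes "assoc_subalgebra F T A" "x \<in> T"
  shows "\<ominus>\<^bsub>A\<lparr>carrier := T\<rparr>\<^esub> x = \<ominus> x" "\<ominus> x \<in> T"
proof -
  interpret T: assoc_algebra F "A\<lparr>carrier := T\<rparr>" using assms(1) by (rule assoc_subalgebra_algebra)
  have x: "x \<in> carrier A" using assoc_subalgebraD(1)[OF assms(1)] assms(2) by blast
  have "\<ominus>\<^bsub>F\<^esub> \<one>\<^bsub>F\<^esub> \<odot> x \<in> T" using assoc_subalgebraD(4)[OF assms(1)] assms(2) by simp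
  then show minus: "\<ominus> x \<in> T" using x by (simp add: smult_l_minus)
  show "\<ominus>\<^bsub>A\<lparr>carrier := T\<rparr>\<^esub> x = \<ominus> x"
    using assms(2) minus x by (intro T.M.minus_equality) (simp_all add: M.l_neg)
qed

text \<open>
  Right quasi-inverses everywhere suffice: the right quasi-inverse of a right quasi-inverse of \<open>x\<close> is \<open>x\<close>.
\<close>

lemma is_jacobson_radical_right:
  assumes "\<And>x. x \<in> carrier A \<Longrightarrow> \<exists>y\<in>carrier A. x \<oplus> y \<ominus> x \<otimes> y = \<zero>"
  shows "is_jacobson_radical A"
  unfolding is_jacobson_radical_iff_quasi_regular
proof
  fix x assume x: "x \<in> carrier A"
  obtain y where y: "y \<in> carrier A" "x \<oplus> y \<ominus> x \<otimes> y = \<zero>" using assms[OF x] by blast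
  obtain z where z: "z \<in> carrier A" "y \<oplus> z \<ominus> y \<otimes> z = \<zero>" using assms[OF y(1)] by blast
  have "z = x" using circle_assoc[OF x y(1) z(1)] x y z by (simp add: M.minus_eq)
  then show "quasi_regular A x" using x y z M.a_comm unfolding quasi_regular_def by metis
qed

lemma generated_subalgebra_least:
  "assoc_subalgebra F T A \<Longrightarrow> S \<subseteq> T \<Longrightarrow> generated_subalgebra F A S \<subseteq> T"
  by (auto simp: generated_subalgebra_def)

lemma generated_subalgebra_superset: "S \<subseteq> generated_subalgebra F A S"
  by (auto simp: generated_subalgebra_def)

lemma generated_subalgebra_subalgebra:
  assumes "S \<subseteq> carrier A"
  shows "assoc_subalgebra F (generated_subalgebra F A S) A"
proof (rule assoc_subalgebraI)
  show "generated_subalgebra F A S \<subseteq> carrier A"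
    using assoc_subalgebra_carrier assms by (rule generated_subalgebra_least)
qed (auto simp: generated_subalgebra_def dest: assoc_subalgebraD)

lemma subalgebra_of_subalgebra:
  assumes "assoc_subalgebra F E A" "assoc_subalgebra F T (A\<lparr>carrier := E\<rparr>)"
  shows "assoc_subalgebra F T A"
proof -
  interpret E: assoc_algebra F "A\<lparr>carrier := E\<rparr>" using assms(1) by (rule assoc_subalgebra_algebra)
  show ?thesis
    using E.assoc_subalgebraD[OF assms(2)] assoc_subalgebraD(1)[OF assms(1)]
    by (intro assoc_subalgebraI) auto
qed

lemma finitely_generated_generated_subalgebra:
  assumes "finite S" "S \<subseteq> carrier A"
  shows "finitely_generated_algebra F (A\<lparr>carrier := generated_subalgebra F A S\<rparr>)"
proof -
  let ?E = "generated_subalgebra F A S"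
  let ?B = "A\<lparr>carrier := ?E\<rparr>"
  have E: "assoc_subalgebra F ?E A" using assms(2) by (rule generated_subalgebra_subalgebra)
  interpret E: assoc_algebra F ?B using E by (rule assoc_subalgebra_algebra)
  have "generated_subalgebra F ?B S \<subseteq> ?E"
    using E.generated_subalgebra_least[OF E.assoc_subalgebra_carrier] generated_subalgebra_superset
    by simp
  moreover have "?E \<subseteq> generated_subalgebra F ?B S"
    using E.generated_subalgebra_subalgebra[of S] generated_subalgebra_superset[of S]
      E.generated_subalgebra_superset[of S] subalgebra_of_subalgebra[OF E]
    by (intro generated_subalgebra_least) simp_all
  ultimately show ?thesis
    using assms(1) generated_subalgebra_superset[of S] unfolding finitely_generated_algebra_def
    by (intro exI[of _ S]) simp
qed

lemma span_mult_closed: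
  assumes S: "S \<subseteq> carrier A" and closed: "\<And>s t. s \<in> S \<Longrightarrow> t \<in> S \<Longrightarrow> s \<otimes> t \<in> S"
  shows "assoc_subalgebra F (span S) A"
proof -
  have sub: "submodule F (span S) A" using S by (rule span_is_submodule)
  have span_carrier: "span S \<subseteq> carrier A" using S by (rule span_is_subset2)
  note sp = submodule.m_closed[OF sub] submodule.zero_closed[OF sub] submodule.smult_closed[OF sub]
  have SS: "S \<subseteq> span S" using S by (rule in_own_span)
  have left: "s \<otimes> y \<in> span S" if s: "s \<in> S" and y: "y \<in> span S" for s y
  proof -
    have sc: "s \<in> carrier A" using s S by blast
    have "submodule F {y \<in> carrier A. s \<otimes> y \<in> span S} A"
      using sc sp by (intro submodule_criterion) (auto simp: mult_add_right mult_smult_right)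
    then have "span S \<subseteq> {y \<in> carrier A. s \<otimes> y \<in> span S}"
      using S SS closed[OF s] by (intro span_is_subset) auto
    then show ?thesis using y by blast
  qed
  have "x \<otimes> y \<in> span S" if x: "x \<in> span S" and y: "y \<in> span S" for x y
  proof -
    have yc: "y \<in> carrier A" using y span_carrier by blast
    have "submodule F {x \<in> carrier A. x \<otimes> y \<in> span S} A"
      using yc sp by (intro submodule_criterion) (auto simp: mult_add_left mult_smult_left)
    then have "span S \<subseteq> {x \<in> carrier A. x \<otimes> y \<in> span S}"
      using S left[OF _ y] by (intro span_is_subset) auto
    then show ?thesis using x by blast
  qed
  then show ?thesis using span_carrier sp by (intro assoc_subalgebraI) auto
qed

inductive_set monomials :: "'c set \<Rightarrow> 'c set" for S where
  generator: "x \<in> S \<Longrightarrow> x \<in> monomials S"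
| product: "x \<in> S \<Longrightarrow> y \<in> monomials S \<Longrightarrow> x \<otimes> y \<in> monomials S"

lemma monomials_carrier: "S \<subseteq> carrier A \<Longrightarrow> monomials S \<subseteq> carrier A"
proof
  show "x \<in> carrier A" if "S \<subseteq> carrier A" "x \<in> monomials S" for x
    using that(2,1) by induction (auto intro: mult_closed)
qed

lemma monomials_mult:
  assumes S: "S \<subseteq> carrier A" and "x \<in> monomials S" "y \<in> monomials S"
  shows "x \<otimes> y \<in> monomials S"
  using assms(2,3)
proof induction
  case (product x z)
  have "x \<otimes> z \<otimes> y = x \<otimes> (z \<otimes> y)"
    using product S monomials_carrier[OF S] by (intro mult_assoc) auto
  then show ?case using product by (simp add: monomials.product)
qed (rule monomials.product)

lemma countable_monomials:
  assumes "countable S"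
  shows "countable (monomials S)"
proof -
  have "monomials S \<subseteq> (\<lambda>xs. foldr (\<otimes>) (tl xs) (hd xs)) ` lists S"
  proof
    fix x assume "x \<in> monomials S"
    then have "\<exists>xs\<in>lists S. xs \<noteq> [] \<and> x = foldr (\<otimes>) (tl xs) (hd xs)"
    proof induction
      case (generator x)
      then show ?case by (intro bexI[of _ "[x]"]) auto
    next
      case (product x y)
      then obtain z zs where "z # zs \<in> lists S" "y = foldr (\<otimes>) zs z"
        by (metis list.exhaust_sel)
      then show ?case using product.hyps(1) by (intro bexI[of _ "z # x # zs"]) auto
    qed
    then show "x \<in> (\<lambda>xs. foldr (\<otimes>) (tl xs) (hd xs)) ` lists S" by blast
  qed
  then show ?thesis using assms by (metis countable_image countable_lists countable_subset)
qed

lemma finitely_generated_countable_span: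
  assumes "finitely_generated_algebra F A"
  obtains C where "countable C" "C \<subseteq> carrier A" "span C = carrier A"
proof -
  obtain S where S: "finite S" "S \<subseteq> carrier A" "generated_subalgebra F A S = carrier A"
    using assms by (auto simp: finitely_generated_algebra_def)
  have M: "monomials S \<subseteq> carrier A" using S(2) by (rule monomials_carrier)
  have "assoc_subalgebra F (span (monomials S)) A"
    using M monomials_mult[OF S(2)] by (rule span_mult_closed)
  moreover have "S \<subseteq> span (monomials S)"
    using in_own_span[OF M] monomials.generator by blast
  ultimately have "carrier A \<subseteq> span (monomials S)"
    using generated_subalgebra_least S(3) by blast
  then have "span (monomials S) = carrier A" using span_is_subset2[OF M] by blast
  then show ?thesis using that M countable_monomials[of S] S(1) by (simp add: countable_finite)
qed

text \<open>
  Every element is a combination of a countable set; choosing the coefficients for each element is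
  injective, because the element can be computed from them.
\<close>

lemma countable_span_injection:
  assumes C: "countable C" "C \<subseteq> carrier A" "span C = carrier A"
  obtains \<theta> :: "'c \<Rightarrow> nat \<Rightarrow> 'a" where "inj_on \<theta> (carrier A)"
proof -
  define value_of where "value_of t = (\<Oplus>v\<in>{v \<in> C. t (to_nat_on C v) \<noteq> \<zero>\<^bsub>F\<^esub>}. t (to_nat_on C v) \<odot> v)"
    for t :: "nat \<Rightarrow> 'a"
  have "\<exists>t. value_of t = x" if "x \<in> carrier A" for x
  proof -
    obtain a S where S: "finite S" "S \<subseteq> C" "a \<in> S \<rightarrow> carrier F" "x = lincomb a S"
      using \<open>x \<in> carrier A\<close> unfolding C(3)[symmetric] span_def by blast
    define t where "t n = (if n \<in> to_nat_on C ` S then a (from_nat_into C n) else \<zero>\<^bsub>F\<^esub>)" for n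
    have t: "t (to_nat_on C v) = (if v \<in> S then a v else \<zero>\<^bsub>F\<^esub>)" if "v \<in> C" for v
    proof -
      have "to_nat_on C v \<in> to_nat_on C ` S \<longleftrightarrow> v \<in> S"
        using that S(2) C(1) by (intro inj_on_image_mem_iff[of _ C]) (auto intro: inj_on_to_nat_on)
      then show ?thesis using that C(1) by (simp add: t_def from_nat_into_to_nat_on)
    qed
    have "value_of t = (\<Oplus>v\<in>S. a v \<odot> v)"
      unfolding value_of_def
    proof (rule M.add.finprod_mono_neutral_cong_left)
      show "finite S" by fact
      show "{v \<in> C. t (to_nat_on C v) \<noteq> \<zero>\<^bsub>F\<^esub>} \<subseteq> S"
        using t by (auto split: if_splits)
      show "a v \<odot> v = \<zero>" if "v \<in> S - {v \<in> C. t (to_nat_on C v) \<noteq> \<zero>\<^bsub>F\<^esub>}" for v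
      proof -
        have "v \<in> C" "a v = \<zero>\<^bsub>F\<^esub>" using that t[of v] S(2) by auto
        then show ?thesis using C(2) by auto
      qed
      show "t (to_nat_on C v) \<odot> v = a v \<odot> v" if "v \<in> {v \<in> C. t (to_nat_on C v) \<noteq> \<zero>\<^bsub>F\<^esub>}" for v
        using that t[of v] by (auto split: if_splits)
      show "(\<lambda>v. a v \<odot> v) \<in> S \<rightarrow> carrier A" using S(2,3) C(2) by auto
    qed
    then show ?thesis using S(4) by (auto simp: lincomb_def)
  qed
  then obtain \<theta> where "\<And>x. x \<in> carrier A \<Longrightarrow> value_of (\<theta> x) = x" by metis
  then show ?thesis using that by (metis inj_onI)
qed

definition transported :: "('c \<Rightarrow> 'e) \<Rightarrow> ('a, 'e) module" where
  "transported \<theta> = (let \<eta> = inv_into (carrier A) \<theta> in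
    \<lparr>carrier = \<theta> ` carrier A, mult = (\<lambda>x y. \<theta> (\<eta> x \<otimes> \<eta> y)), one = \<theta> \<zero>, zero = \<theta> \<zero>,
     add = (\<lambda>x y. \<theta> (\<eta> x \<oplus> \<eta> y)), smult = (\<lambda>c x. \<theta> (c \<odot> \<eta> x))\<rparr>)"

context
  fixes \<theta> :: "'c \<Rightarrow> 'e" and B
  assumes inj: "inj_on \<theta> (carrier A)"
  defines "B \<equiv> transported \<theta>"
begin

lemma transported_simps:
  shows "carrier B = \<theta> ` carrier A" "\<zero>\<^bsub>B\<^esub> = \<theta> \<zero>"
    and "x \<in> carrier A \<Longrightarrow> y \<in> carrier A \<Longrightarrow> \<theta> x \<otimes>\<^bsub>B\<^esub> \<theta> y = \<theta> (x \<otimes> y)"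
    and "x \<in> carrier A \<Longrightarrow> y \<in> carrier A \<Longrightarrow> \<theta> x \<oplus>\<^bsub>B\<^esub> \<theta> y = \<theta> (x \<oplus> y)"
    and "x \<in> carrier A \<Longrightarrow> c \<odot>\<^bsub>B\<^esub> \<theta> x = \<theta> (c \<odot> x)"
  using inj by (simp_all add: B_def transported_def Let_def)

lemma transported_algebra: "assoc_algebra F B"
proof -
  note simps = transported_simps mult_closed
  have "Module.module F B"
  proof (rule module_criteria)
    show "cring F" by (rule R.is_cring)
    show "\<forall>v\<in>carrier B. \<exists>w\<in>carrier B. v \<oplus>\<^bsub>B\<^esub> w = \<zero>\<^bsub>B\<^esub>"
    proof
      fix v assume "v \<in> carrier B"
      then obtain x where "x \<in> carrier A" "v = \<theta> x" by (auto simp: simps)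
      then show "\<exists>w\<in>carrier B. v \<oplus>\<^bsub>B\<^esub> w = \<zero>\<^bsub>B\<^esub>"
        by (intro bexI[of _ "\<theta> (\<ominus> x)"]) (auto simp: simps M.r_neg)
    qed
  qed (auto simp: simps M.a_ac smult_l_distr smult_r_distr smult_assoc1)
  moreover have "assoc_algebra_axioms F B"
    by unfold_locales
      (auto simp: simps mult_assoc mult_add_left mult_add_right mult_smult_left mult_smult_right)
  ultimately show ?thesis
    using field_axioms by (simp add: assoc_algebra_def vectorspace_def)
qed

lemma transported_hom: "\<theta> \<in> algebra_hom F A B"
  by (auto simp: algebra_hom_def LinearCombinations.module_hom_def hom_def transported_simps)

lemma transported_quasi_regular:
  assumes "x \<in> carrier A" "quasi_regular A x"
  shows "quasi_regular B (\<theta> x)"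
proof -
  interpret B: assoc_algebra F B by (rule transported_algebra)
  obtain y where y: "y \<in> carrier A" "x \<oplus> y \<ominus> x \<otimes> y = \<zero>" "x \<oplus> y \<ominus> y \<otimes> x = \<zero>"
    using assms(2) by (auto simp: quasi_regular_def)
  have "\<ominus>\<^bsub>B\<^esub> \<theta> z = \<theta> (\<ominus> z)" if "z \<in> carrier A" for z
    using that by (intro B.M.minus_equality) (auto simp: transported_simps M.l_neg)
  then have "\<theta> u \<ominus>\<^bsub>B\<^esub> \<theta> z = \<theta> (u \<ominus> z)" if "u \<in> carrier A" "z \<in> carrier A" for u z
    using that by (simp add: B.M.minus_eq M.minus_eq transported_simps)
  then have "\<theta> u \<oplus>\<^bsub>B\<^esub> \<theta> v \<ominus>\<^bsub>B\<^esub> \<theta> z \<otimes>\<^bsub>B\<^esub> \<theta> w = \<theta> (u \<oplus> v \<ominus> z \<otimes> w)"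
    if "u \<in> carrier A" "v \<in> carrier A" "z \<in> carrier A" "w \<in> carrier A" for u v z w
    using that by (simp add: transported_simps mult_closed)
  from this[OF assms(1) y(1) assms(1) y(1)] this[OF assms(1) y(1) y(1) assms(1)]
  show ?thesis
    using y unfolding quasi_regular_def by (intro bexI[of _ "\<theta> y"]) (simp_all add: transported_simps(1,2))
qed

lemma transported_finitely_generated:
  assumes "finitely_generated_algebra F A"
  shows "finitely_generated_algebra F B"
proof -
  interpret B: assoc_algebra F B by (rule transported_algebra)
  obtain S where S: "finite S" "S \<subseteq> carrier A" "generated_subalgebra F A S = carrier A"
    using assms by (auto simp: finitely_generated_algebra_def)
  have S': "\<theta> ` S \<subseteq> carrier B" using S(2) by (auto simp: transported_simps)
  let ?G = "generated_subalgebra F B (\<theta> ` S)"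
  note G = B.assoc_subalgebraD[OF B.generated_subalgebra_subalgebra[OF S']]
  have "assoc_subalgebra F {x \<in> carrier A. \<theta> x \<in> ?G} A"
  proof (rule assoc_subalgebraI)
    show "\<zero> \<in> {x \<in> carrier A. \<theta> x \<in> ?G}" using G(2) by (simp add: transported_simps)
    show "x \<oplus> y \<in> {x \<in> carrier A. \<theta> x \<in> ?G}"
      if "x \<in> {x \<in> carrier A. \<theta> x \<in> ?G}" "y \<in> {x \<in> carrier A. \<theta> x \<in> ?G}" for x y
      using that G(3)[of "\<theta> x" "\<theta> y"] by (simp add: transported_simps)
    show "x \<otimes> y \<in> {x \<in> carrier A. \<theta> x \<in> ?G}"
      if "x \<in> {x \<in> carrier A. \<theta> x \<in> ?G}" "y \<in> {x \<in> carrier A. \<theta> x \<in> ?G}" for x y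
      using that G(5)[of "\<theta> x" "\<theta> y"] by (simp add: transported_simps mult_closed)
    show "c \<odot> x \<in> {x \<in> carrier A. \<theta> x \<in> ?G}"
      if "c \<in> carrier F" "x \<in> {x \<in> carrier A. \<theta> x \<in> ?G}" for c x
      using that G(4)[of c "\<theta> x"] by (simp add: transported_simps)
  qed auto
  moreover have "S \<subseteq> {x \<in> carrier A. \<theta> x \<in> ?G}"
    using S(2) B.generated_subalgebra_superset[of "\<theta> ` S"] by auto
  ultimately have "carrier A \<subseteq> {x \<in> carrier A. \<theta> x \<in> ?G}"
    using generated_subalgebra_least S(3) by blast
  then have "carrier B \<subseteq> ?G" by (auto simp: transported_simps)
  then show ?thesis
    using S(1) S' G(1) unfolding finitely_generated_algebra_def by (intro exI[of _ "\<theta> ` S"]) auto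
qed

end

theorem finitely_generated_on_sequences:
  assumes fg: "finitely_generated_algebra F A" and rad: "is_jacobson_radical A"
  shows "\<exists>(B :: ('a, nat \<Rightarrow> 'a) module) \<theta>. assoc_algebra F B \<and> finitely_generated_algebra F B \<and>
    is_jacobson_radical B \<and> \<theta> \<in> algebra_hom F A B \<and> inj_on \<theta> (carrier A)"
proof -
  obtain C where C: "countable C" "C \<subseteq> carrier A" "span C = carrier A"
    using finitely_generated_countable_span[OF fg] by blast
  obtain \<theta> :: "'c \<Rightarrow> nat \<Rightarrow> 'a" where \<theta>: "inj_on \<theta> (carrier A)"
    using countable_span_injection[OF C] by blast
  let ?B = "transported \<theta>"
  interpret B: assoc_algebra F ?B using \<theta> by (rule transported_algebra)
  have "quasi_regular ?B y" if y: "y \<in> carrier ?B" for y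
    using y transported_quasi_regular[OF \<theta>] rad
    by (auto simp: transported_simps(1)[OF \<theta>] is_jacobson_radical_iff_quasi_regular)
  then have "is_jacobson_radical ?B" by (simp add: B.is_jacobson_radical_iff_quasi_regular)
  then show ?thesis
    using transported_finitely_generated[OF \<theta> fg] transported_hom[OF \<theta>] \<theta> B.assoc_algebra_axioms
    by blast
qed

end

section \<open>Adjoining a unit\<close>

context assoc_algebra
begin

definition unitization :: "('a, 'a \<times> 'c) module" where
  "unitization = \<lparr>carrier = carrier F \<times> carrier A,
     mult = (\<lambda>(s, x) (t, y). (s \<otimes>\<^bsub>F\<^esub> t, s \<odot> y \<oplus> t \<odot> x \<oplus> x \<otimes> y)),
     one = (\<one>\<^bsub>F\<^esub>, \<zero>), zero = (\<zero>\<^bsub>F\<^esub>, \<zero>),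
     add = (\<lambda>(s, x) (t, y). (s \<oplus>\<^bsub>F\<^esub> t, x \<oplus> y)),
     smult = (\<lambda>c (s, x). (c \<otimes>\<^bsub>F\<^esub> s, c \<odot> x))\<rparr>"

lemma smult_lcomm:
  "\<lbrakk>s \<in> carrier F; t \<in> carrier F; x \<in> carrier A\<rbrakk> \<Longrightarrow> s \<odot> (t \<odot> x) = t \<odot> (s \<odot> x)"
  by (metis R.m_comm smult_assoc1)

lemma unitization_algebra: "assoc_algebra F unitization"
proof -
  note simps = unitization_def mult_closed R.m_assoc R.m_lcomm R.m_comm R.l_distr R.r_distr
    R.a_ac M.a_ac smult_l_distr smult_r_distr smult_assoc1 smult_lcomm
    mult_assoc mult_add_left mult_add_right mult_smult_left mult_smult_right
  have "Module.module F unitization"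
  proof (rule module_criteria)
    show "cring F" by (rule R.is_cring)
    show "\<forall>v\<in>carrier unitization. \<exists>w\<in>carrier unitization. v \<oplus>\<^bsub>unitization\<^esub> w = \<zero>\<^bsub>unitization\<^esub>"
    proof
      fix v assume "v \<in> carrier unitization"
      then show "\<exists>w\<in>carrier unitization. v \<oplus>\<^bsub>unitization\<^esub> w = \<zero>\<^bsub>unitization\<^esub>"
        by (intro bexI[of _ "(\<ominus>\<^bsub>F\<^esub> fst v, \<ominus> snd v)"])
          (auto simp: unitization_def M.r_neg R.r_neg)
    qed
  qed (auto simp: simps)
  moreover have "assoc_algebra_axioms F unitization"
    by unfold_locales (auto simp: simps)
  ultimately show ?thesis
    using field_axioms by (simp add: assoc_algebra_def vectorspace_def)
qed

lemma unitization_simps: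
  "\<one>\<^bsub>unitization\<^esub> \<in> carrier unitization"
  "x \<in> carrier unitization \<Longrightarrow> \<one>\<^bsub>unitization\<^esub> \<otimes>\<^bsub>unitization\<^esub> x = x"
  "x \<in> carrier unitization \<Longrightarrow> x \<otimes>\<^bsub>unitization\<^esub> \<one>\<^bsub>unitization\<^esub> = x"
  by (auto simp: unitization_def)

lemma unitization_embedding: "Pair \<zero>\<^bsub>F\<^esub> \<in> algebra_hom F A unitization"
  by (auto simp: algebra_hom_def LinearCombinations.module_hom_def hom_def unitization_def mult_closed)

lemma unitization_ideal:
  assumes "x \<in> {\<zero>\<^bsub>F\<^esub>} \<times> carrier A" "u \<in> carrier unitization"
  shows "x \<otimes>\<^bsub>unitization\<^esub> u \<in> {\<zero>\<^bsub>F\<^esub>} \<times> carrier A" "u \<otimes>\<^bsub>unitization\<^esub> x \<in> {\<zero>\<^bsub>F\<^esub>} \<times> carrier A"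
  using assms by (auto simp: unitization_def mult_closed)

end

section \<open>The module on which the operators act\<close>

text \<open>
  The component at \<open>None\<close> is the first summand of \<open>U \<oplus> Hom(N\<^sup>1, U)\<close>, and the components at \<open>Some w\<close>
  are the values of the linear map at the words \<open>w\<close>.
\<close>

type_synonym 'u vec = "letter list option \<Rightarrow> 'u"

text \<open>
  \<open>U\<close> is a unital algebra with an ideal \<open>I\<close> of quasi-regular elements; in the application it is the
  unitization of the given algebra, and \<open>I\<close> is the given algebra. The function \<open>\<gamma>\<close> is the linear map from
  the algebra with the relations above onto \<open>I\<close>.
\<close>

locale wreath = assoc_algebra F U for F and U (structure) +
  fixes I :: "'c set" and \<gamma> :: "letter list \<Rightarrow> 'c"
  assumes unit: "\<one> \<in> carrier U" "\<And>x. x \<in> carrier U \<Longrightarrow> \<one> \<otimes> x = x"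
      "\<And>x. x \<in> carrier U \<Longrightarrow> x \<otimes> \<one> = x"
    and ideal_carrier: "I \<subseteq> carrier U" and ideal_zero: "\<zero> \<in> I"
    and ideal_add: "\<And>x y. x \<in> I \<Longrightarrow> y \<in> I \<Longrightarrow> x \<oplus> y \<in> I"
    and ideal_right: "\<And>x u. x \<in> I \<Longrightarrow> u \<in> carrier U \<Longrightarrow> x \<otimes> u \<in> I"
    and ideal_left: "\<And>x u. x \<in> I \<Longrightarrow> u \<in> carrier U \<Longrightarrow> u \<otimes> x \<in> I"
    and quasi_inverse: "\<And>x. x \<in> I \<Longrightarrow> \<exists>y\<in>I. x \<oplus> y \<ominus> x \<otimes> y = \<zero>"
    and \<gamma>_ideal: "\<And>w. \<gamma> w \<in> I" and \<gamma>_annihilates: "annihilates_relators U \<gamma>"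
    and \<gamma>_spans: "I \<subseteq> span (\<gamma> ` {w. w \<noteq> []})"
begin

sublocale U: ring U
  using unit by (rule unital_ring)

lemma smult_via_unit: "c \<in> carrier F \<Longrightarrow> x \<in> carrier U \<Longrightarrow> c \<odot> x = x \<otimes> (c \<odot> \<one>)"
  using unit by (simp add: mult_smult_right)

definition V :: "'c vec set" where
  "V = {v. (\<forall>i. v i \<in> carrier U) \<and> annihilates_relators U (\<lambda>w. v (Some w))}"

text \<open>
  This set and the next one are invariant under all operators that will be considered. The first
  contains the vector at which \<open>L_sandwich\<close> and \<open>P_sandwich\<close> evaluate operators, the second the one
  of \<open>Q_sandwich\<close>, and their invariance is the reason why the resulting coefficients of \<open>P r P\<close> and \<open>Q r Q\<close> lie in \<open>I\<close>.
\<close>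

definition V_lower :: "'c vec set" where "V_lower = {v \<in> V. \<forall>w. v (Some w) \<in> I}"

definition V_ideal :: "'c vec set" where "V_ideal = {v \<in> V. \<forall>i. v i \<in> I}"

lemma V_carrier [simp]: "v \<in> V \<Longrightarrow> v i \<in> carrier U" by (simp add: V_def)

lemma V_add [simp]: "v \<in> V \<Longrightarrow> w \<in> V \<Longrightarrow> (\<lambda>i. v i \<oplus> w i) \<in> V"
  using U.annihilates_relators_add[of "\<lambda>z. v (Some z)" "\<lambda>z. w (Some z)"] by (simp add: V_def del: V_carrier)

lemma V_mult [simp]: "v \<in> V \<Longrightarrow> u \<in> carrier U \<Longrightarrow> (\<lambda>i. v i \<otimes> u) \<in> V"
  using U.annihilates_relators_mult_right[of "\<lambda>z. v (Some z)" u]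
  by (simp add: V_def mult_closed del: V_carrier)

lemma V_zero [simp]: "(\<lambda>i. \<zero>) \<in> V"
  using U.annihilates_relators_zero by (simp add: V_def del: V_carrier)

lemma V_smult [simp]:
  assumes "v \<in> V" "c \<in> carrier F" shows "(\<lambda>i. c \<odot> v i) \<in> V"
proof -
  have "(\<lambda>i. c \<odot> v i) = (\<lambda>i. v i \<otimes> (c \<odot> \<one>))"
    using assms by (intro ext smult_via_unit) simp_all
  then show ?thesis using assms unit(1) by simp
qed

lemma ideal_smult: "x \<in> I \<Longrightarrow> c \<in> carrier F \<Longrightarrow> c \<odot> x \<in> I"
  using ideal_right[of x "c \<odot> \<one>"] ideal_carrier unit(1)
  by (subst smult_via_unit) auto

text \<open>
  Linearity over \<open>U\<close> from the right includes linearity over the field, since \<open>c \<odot> x = x \<otimes> (c \<odot> 1)\<close>.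
\<close>

definition linear_op :: "('c vec \<Rightarrow> 'c vec) \<Rightarrow> bool" where
  "linear_op f \<longleftrightarrow> f \<in> V \<rightarrow> V \<and>
     (\<forall>v\<in>V. \<forall>w\<in>V. f (\<lambda>i. v i \<oplus> w i) = (\<lambda>i. f v i \<oplus> f w i)) \<and>
     (\<forall>v\<in>V. \<forall>u\<in>carrier U. f (\<lambda>i. v i \<otimes> u) = (\<lambda>i. f v i \<otimes> u)) \<and>
     f \<in> V_lower \<rightarrow> V_lower \<and> f \<in> V_ideal \<rightarrow> V_ideal"

text \<open>
  Operators are extensional functions, so that they are equal as soon as they agree on \<open>V\<close>.
\<close>

definition op_algebra :: "('a, 'c vec \<Rightarrow> 'c vec) module" where
  "op_algebra = \<lparr>carrier = {f \<in> extensional V. linear_op f}, mult = compose V, one = (\<lambda>v\<in>V. v),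
     zero = (\<lambda>v\<in>V. \<lambda>i. \<zero>), add = (\<lambda>f g. \<lambda>v\<in>V. \<lambda>i. f v i \<oplus> g v i),
     smult = (\<lambda>c f. \<lambda>v\<in>V. \<lambda>i. c \<odot> f v i)\<rparr>"

abbreviation "\<A> \<equiv> op_algebra"

lemma lower_V: "v \<in> V_lower \<Longrightarrow> v \<in> V" "v \<in> V_ideal \<Longrightarrow> v \<in> V"
  by (auto simp: V_lower_def V_ideal_def)

lemma linear_opD:
  assumes "linear_op f"
  shows "v \<in> V \<Longrightarrow> f v \<in> V"
    and "v \<in> V \<Longrightarrow> w \<in> V \<Longrightarrow> f (\<lambda>i. v i \<oplus> w i) = (\<lambda>i. f v i \<oplus> f w i)"
    and "v \<in> V \<Longrightarrow> u \<in> carrier U \<Longrightarrow> f (\<lambda>i. v i \<otimes> u) = (\<lambda>i. f v i \<otimes> u)"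
    and "v \<in> V_lower \<Longrightarrow> f v \<in> V_lower"
    and "v \<in> V_ideal \<Longrightarrow> f v \<in> V_ideal"
  using assms by (auto simp: linear_op_def)

lemma linear_opI:
  assumes "\<And>v. v \<in> V \<Longrightarrow> f v \<in> V"
    and "\<And>v w. v \<in> V \<Longrightarrow> w \<in> V \<Longrightarrow> f (\<lambda>i. v i \<oplus> w i) = (\<lambda>i. f v i \<oplus> f w i)"
    and "\<And>v u. v \<in> V \<Longrightarrow> u \<in> carrier U \<Longrightarrow> f (\<lambda>i. v i \<otimes> u) = (\<lambda>i. f v i \<otimes> u)"
    and "\<And>v w. v \<in> V_lower \<Longrightarrow> f v (Some w) \<in> I"
    and "\<And>v i. v \<in> V_ideal \<Longrightarrow> f v i \<in> I"
  shows "linear_op f"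
  unfolding linear_op_def
proof (intro conjI ballI funcsetI)
  show "f v \<in> V_lower" if "v \<in> V_lower" for v
    using assms(1)[OF lower_V(1)[OF that]] assms(4)[OF that] by (simp add: V_lower_def)
  show "f v \<in> V_ideal" if "v \<in> V_ideal" for v
    using assms(1)[OF lower_V(2)[OF that]] assms(5)[OF that] by (simp add: V_ideal_def)
qed (simp_all add: assms(1-3))

lemma restrict_op: "linear_op f \<Longrightarrow> restrict f V \<in> carrier \<A>"
  using lower_V by (auto simp: op_algebra_def linear_op_def)

lemma op_linear: "f \<in> carrier \<A> \<Longrightarrow> linear_op f"
  by (simp add: op_algebra_def)

lemma op_eqI:
  assumes "f \<in> carrier \<A>" "g \<in> carrier \<A>" "\<And>v i. v \<in> V \<Longrightarrow> f v i = g v i"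
  shows "f = g"
  using assms by (intro extensionalityI[of _ V]) (auto simp: op_algebra_def)

lemma op_apply [simp]:
  assumes "v \<in> V"
  shows "(f \<otimes>\<^bsub>\<A>\<^esub> g) v = f (g v)" "\<one>\<^bsub>\<A>\<^esub> v = v" "\<zero>\<^bsub>\<A>\<^esub> v = (\<lambda>i. \<zero>)"
    "(f \<oplus>\<^bsub>\<A>\<^esub> g) v = (\<lambda>i. f v i \<oplus> g v i)" "(c \<odot>\<^bsub>\<A>\<^esub> f) v = (\<lambda>i. c \<odot> f v i)"
  using assms by (auto simp: op_algebra_def compose_def)

lemma op_smult_linear:
  assumes "linear_op f" "v \<in> V" "c \<in> carrier F"
  shows "f (\<lambda>i. c \<odot> v i) = (\<lambda>i. c \<odot> f v i)"
proof -
  have "(\<lambda>i. c \<odot> v i) = (\<lambda>i. v i \<otimes> (c \<odot> \<one>))"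
    using assms by (intro ext smult_via_unit) simp_all
  moreover have "(\<lambda>i. c \<odot> f v i) = (\<lambda>i. f v i \<otimes> (c \<odot> \<one>))"
    using assms linear_opD(1) by (intro ext smult_via_unit) simp_all
  ultimately show ?thesis using linear_opD(3)[OF assms(1,2)] assms(3) unit(1) by simp
qed

lemma op_V [simp]: "f \<in> carrier \<A> \<Longrightarrow> v \<in> V \<Longrightarrow> f v \<in> V"
  using linear_opD(1) op_linear by blast

lemma op_closed [simp]:
  shows "f \<in> carrier \<A> \<Longrightarrow> g \<in> carrier \<A> \<Longrightarrow> f \<otimes>\<^bsub>\<A>\<^esub> g \<in> carrier \<A>"
    and "\<one>\<^bsub>\<A>\<^esub> \<in> carrier \<A>" and "\<zero>\<^bsub>\<A>\<^esub> \<in> carrier \<A>"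
    and "f \<in> carrier \<A> \<Longrightarrow> g \<in> carrier \<A> \<Longrightarrow> f \<oplus>\<^bsub>\<A>\<^esub> g \<in> carrier \<A>"
    and "c \<in> carrier F \<Longrightarrow> f \<in> carrier \<A> \<Longrightarrow> c \<odot>\<^bsub>\<A>\<^esub> f \<in> carrier \<A>"
proof -
  show "f \<otimes>\<^bsub>\<A>\<^esub> g \<in> carrier \<A>" if "f \<in> carrier \<A>" "g \<in> carrier \<A>"
  proof -
    note f = linear_opD[OF op_linear[OF that(1)]] and g = linear_opD[OF op_linear[OF that(2)]]
    have "linear_op (\<lambda>v. f (g v))"
      using f g by (simp add: linear_op_def)
    then have "restrict (\<lambda>v. f (g v)) V \<in> carrier \<A>" by (rule restrict_op)
    then show ?thesis by (simp add: op_algebra_def compose_def)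
  qed
  show "\<one>\<^bsub>\<A>\<^esub> \<in> carrier \<A>"
  proof -
    have "linear_op (\<lambda>v. v)" by (simp add: linear_op_def)
    then have "restrict (\<lambda>v. v) V \<in> carrier \<A>" by (rule restrict_op)
    then show ?thesis by (simp add: op_algebra_def)
  qed
  show "\<zero>\<^bsub>\<A>\<^esub> \<in> carrier \<A>"
  proof -
    have "linear_op (\<lambda>v i. \<zero>)" by (rule linear_opI) (simp_all add: ideal_zero)
    then have "restrict (\<lambda>v i. \<zero>) V \<in> carrier \<A>" by (rule restrict_op)
    then show ?thesis by (simp add: op_algebra_def)
  qed
  show "f \<oplus>\<^bsub>\<A>\<^esub> g \<in> carrier \<A>" if "f \<in> carrier \<A>" "g \<in> carrier \<A>"
  proof -
    note f = linear_opD[OF op_linear[OF that(1)]] and g = linear_opD[OF op_linear[OF that(2)]]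
    have "linear_op (\<lambda>v i. f v i \<oplus> g v i)"
    proof (rule linear_opI)
      show "f v (Some w) \<oplus> g v (Some w) \<in> I" if "v \<in> V_lower" for v w
        using f(4)[OF that] g(4)[OF that] by (simp add: V_lower_def ideal_add)
      show "f v i \<oplus> g v i \<in> I" if "v \<in> V_ideal" for v i
        using f(5)[OF that] g(5)[OF that] by (simp add: V_ideal_def ideal_add)
    qed (use f g in \<open>simp_all add: M.a_ac U.l_distr\<close>)
    then have "restrict (\<lambda>v i. f v i \<oplus> g v i) V \<in> carrier \<A>" by (rule restrict_op)
    then show ?thesis by (simp add: op_algebra_def)
  qed
  show "c \<odot>\<^bsub>\<A>\<^esub> f \<in> carrier \<A>" if "c \<in> carrier F" "f \<in> carrier \<A>"
  proof -
    note f = linear_opD[OF op_linear[OF that(2)]]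
    have "linear_op (\<lambda>v i. c \<odot> f v i)"
    proof (rule linear_opI)
      show "c \<odot> f v (Some w) \<in> I" if "v \<in> V_lower" for v w
        using f(4)[OF that] \<open>c \<in> carrier F\<close> by (simp add: V_lower_def ideal_smult)
      show "c \<odot> f v i \<in> I" if "v \<in> V_ideal" for v i
        using f(5)[OF that] \<open>c \<in> carrier F\<close> by (simp add: V_ideal_def ideal_smult)
    qed (use f that(1) in \<open>simp_all add: smult_r_distr mult_smult_left\<close>)
    then have "restrict (\<lambda>v i. c \<odot> f v i) V \<in> carrier \<A>" by (rule restrict_op)
    then show ?thesis by (simp add: op_algebra_def)
  qed
qed

lemma op_algebra_assoc: "assoc_algebra F \<A>"
proof -
  note op = op_linear[THEN linear_opD(2)]
  have "Module.module F \<A>"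
  proof (rule module_criteria)
    show "cring F" by (rule R.is_cring)
    show "\<forall>f\<in>carrier \<A>. \<exists>g\<in>carrier \<A>. f \<oplus>\<^bsub>\<A>\<^esub> g = \<zero>\<^bsub>\<A>\<^esub>"
    proof
      fix f assume f: "f \<in> carrier \<A>"
      have "f \<oplus>\<^bsub>\<A>\<^esub> (\<ominus>\<^bsub>F\<^esub> \<one>\<^bsub>F\<^esub> \<odot>\<^bsub>\<A>\<^esub> f) = \<zero>\<^bsub>\<A>\<^esub>"
        using f by (intro op_eqI) (simp_all add: smult_l_minus M.r_neg)
      then show "\<exists>g\<in>carrier \<A>. f \<oplus>\<^bsub>\<A>\<^esub> g = \<zero>\<^bsub>\<A>\<^esub>"
        using f by (intro bexI[of _ "\<ominus>\<^bsub>F\<^esub> \<one>\<^bsub>F\<^esub> \<odot>\<^bsub>\<A>\<^esub> f"]) simp_all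
    qed
  qed (auto intro!: op_eqI simp: M.a_ac smult_l_distr smult_r_distr smult_assoc1)
  moreover have "assoc_algebra_axioms F \<A>"
    by unfold_locales
      (auto intro!: op_eqI simp: op_linear[THEN linear_opD(2)] op_smult_linear[OF op_linear])
  ultimately show ?thesis
    using field_axioms by (simp add: assoc_algebra_def vectorspace_def)
qed

end

section \<open>The finitely generated algebra of operators\<close>

context wreath
begin

sublocale op: assoc_algebra F \<A>
  by (rule op_algebra_assoc)

text \<open>
  \<open>P\<close>, \<open>Q\<close> and the left multiplications \<open>L a\<close> all have this form. Multiplying one of them from the
  left by a right linear operator only changes the vector \<open>x\<close> (\<open>op_rank_one\<close>), and the product of two of
  them has the vector of the first and the index of the second (\<open>rank_one_mult\<close>). The identities for
  \<open>P\<close>, \<open>Q\<close> and \<open>L\<close> follow from these two rules.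
\<close>

definition rank_one :: "'c vec \<Rightarrow> 'c \<Rightarrow> letter list option \<Rightarrow> 'c vec \<Rightarrow> 'c vec" where
  "rank_one x a i = (\<lambda>v\<in>V. \<lambda>j. x j \<otimes> (a \<otimes> v i))"

definition \<delta> :: "'c vec" where "\<delta> = (\<lambda>i. case i of None \<Rightarrow> \<one> | Some w \<Rightarrow> \<zero>)"

definition \<gamma>vec :: "'c vec" where "\<gamma>vec = (\<lambda>i. case i of None \<Rightarrow> \<zero> | Some w \<Rightarrow> \<gamma> w)"

definition shift :: "letter list \<Rightarrow> 'c vec \<Rightarrow> 'c vec" where
  "shift u = (\<lambda>v\<in>V. \<lambda>i. case i of None \<Rightarrow> \<zero> | Some w \<Rightarrow> v (Some (w @ u)))"

lemma \<gamma>_carrier [simp]: "\<gamma> w \<in> carrier U"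
  using \<gamma>_ideal ideal_carrier by blast

lemma ideal_in_carrier: "x \<in> I \<Longrightarrow> x \<in> carrier U"
  using ideal_carrier by blast

lemma \<delta>_lower: "\<delta> \<in> V_lower"
  using unit(1) ideal_zero U.annihilates_relators_zero
  by (auto simp: V_lower_def V_def \<delta>_def split: option.splits simp del: V_carrier)

lemma \<gamma>vec_ideal: "\<gamma>vec \<in> V_ideal"
  using \<gamma>_ideal \<gamma>_annihilates \<gamma>_carrier ideal_zero
  by (auto simp: V_ideal_def V_def \<gamma>vec_def split: option.splits simp del: V_carrier)

lemma ideal_vec_lower: "v \<in> V_ideal \<Longrightarrow> v \<in> V_lower"
  by (simp add: V_ideal_def V_lower_def)

lemma \<delta>_simps [simp]: "\<delta> \<in> V" "\<delta> None = \<one>" "\<delta> (Some w) = \<zero>"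
  using lower_V(1)[OF \<delta>_lower] by (simp_all add: \<delta>_def)

lemma \<gamma>vec_simps [simp]: "\<gamma>vec \<in> V" "\<gamma>vec None = \<zero>" "\<gamma>vec (Some w) = \<gamma> w"
  using lower_V(2)[OF \<gamma>vec_ideal] by (simp_all add: \<gamma>vec_def)

lemma rank_one_apply [simp]: "v \<in> V \<Longrightarrow> rank_one x a i v = (\<lambda>j. x j \<otimes> (a \<otimes> v i))"
  by (simp add: rank_one_def)

lemma shift_apply [simp]:
  "v \<in> V \<Longrightarrow> shift u v = (\<lambda>i. case i of None \<Rightarrow> \<zero> | Some w \<Rightarrow> v (Some (w @ u)))"
  by (simp add: shift_def)

lemma rank_one_closed [simp]:
  assumes "x \<in> V_lower" "a \<in> carrier U"
  shows "rank_one x a i \<in> carrier \<A>"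
  unfolding rank_one_def
proof (intro restrict_op linear_opI)
  have x: "x \<in> V" "\<And>w. x (Some w) \<in> I" using assms(1) by (auto simp: V_lower_def)
  show "(\<lambda>j. x j \<otimes> (a \<otimes> v i)) \<in> V" if "v \<in> V" for v
    using x(1) assms(2) that by (simp add: mult_closed)
  show "(\<lambda>j. x j \<otimes> (a \<otimes> (v i \<oplus> w i))) = (\<lambda>j. x j \<otimes> (a \<otimes> v i) \<oplus> x j \<otimes> (a \<otimes> w i))"
    if "v \<in> V" "w \<in> V" for v w
    using x(1) assms(2) that by (simp add: mult_closed mult_add_right)
  show "(\<lambda>j. x j \<otimes> (a \<otimes> (v i \<otimes> u))) = (\<lambda>j. x j \<otimes> (a \<otimes> v i) \<otimes> u)"
    if "v \<in> V" "u \<in> carrier U" for v u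
    using x(1) assms(2) that by (simp add: mult_closed mult_assoc)
  show "x (Some w) \<otimes> (a \<otimes> v i) \<in> I" if "v \<in> V_lower" for v w
    using x(2) assms(2) lower_V(1)[OF that] by (intro ideal_right) (simp_all add: mult_closed)
  show "x j \<otimes> (a \<otimes> v i) \<in> I" if "v \<in> V_ideal" for v j
    using x(1) assms(2) that by (intro ideal_left) (simp_all add: V_ideal_def)
qed

lemma shift_closed [simp]: "shift u \<in> carrier \<A>"
  unfolding shift_def
proof (intro restrict_op linear_opI)
  fix v assume v: "v \<in> V"
  have "annihilates_relators U (\<lambda>w. v (Some (w @ u)))"
    using v U.annihilates_relators_shift[of "\<lambda>w. v (Some w)"] by (simp add: V_def del: V_carrier)
  moreover have "(case i of None \<Rightarrow> \<zero> | Some w \<Rightarrow> v (Some (w @ u))) \<in> carrier U" for i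
    using v by (cases i) simp_all
  ultimately show "(\<lambda>i. case i of None \<Rightarrow> \<zero> | Some w \<Rightarrow> v (Some (w @ u))) \<in> V"
    by (simp add: V_def del: V_carrier)
next
  show "(case i of None \<Rightarrow> \<zero> | Some w \<Rightarrow> v (Some (w @ u))) \<in> I" if "v \<in> V_ideal" for v i
    using that ideal_zero by (cases i) (simp_all add: V_ideal_def)
qed (auto simp: V_lower_def fun_eq_iff split: option.splits)

lemma op_rank_one:
  assumes "f \<in> carrier \<A>" "x \<in> V_lower" "a \<in> carrier U"
  shows "f \<otimes>\<^bsub>\<A>\<^esub> rank_one x a i = rank_one (f x) a i"
proof (rule op_eqI)
  have fx: "f x \<in> V_lower" using linear_opD(4)[OF op_linear[OF assms(1)] assms(2)] .
  show "f \<otimes>\<^bsub>\<A>\<^esub> rank_one x a i \<in> carrier \<A>" "rank_one (f x) a i \<in> carrier \<A>"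
    using assms fx by simp_all
  show "(f \<otimes>\<^bsub>\<A>\<^esub> rank_one x a i) v j = rank_one (f x) a i v j" if "v \<in> V" for v j
    using linear_opD(3)[OF op_linear[OF assms(1)] lower_V(1)[OF assms(2)], of "a \<otimes> v i"] that assms(3)
    by (simp add: mult_closed)
qed

lemma rank_one_mult:
  assumes "x \<in> V_lower" "y \<in> V_lower" "a \<in> carrier U" "b \<in> carrier U"
  shows "rank_one x a i \<otimes>\<^bsub>\<A>\<^esub> rank_one y b j = rank_one x (a \<otimes> y i \<otimes> b) j"
proof (rule op_eqI)
  have "x \<in> V" "y \<in> V" using assms lower_V by auto
  then show "(rank_one x a i \<otimes>\<^bsub>\<A>\<^esub> rank_one y b j) v k = rank_one x (a \<otimes> y i \<otimes> b) j v k"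
    if "v \<in> V" for v k
    using that assms by (simp add: mult_closed mult_assoc)
  show "rank_one x (a \<otimes> y i \<otimes> b) j \<in> carrier \<A>"
    using assms \<open>y \<in> V\<close> by (simp add: mult_closed)
qed (use assms in simp)

definition P :: "'c vec \<Rightarrow> 'c vec" where "P = rank_one \<delta> \<one> (Some [])"
definition Q :: "'c vec \<Rightarrow> 'c vec" where "Q = rank_one \<gamma>vec \<one> None"
definition L :: "'c \<Rightarrow> 'c vec \<Rightarrow> 'c vec" where "L a = rank_one \<delta> a None"

lemma PQL_closed [simp]:
  "P \<in> carrier \<A>" "Q \<in> carrier \<A>" "a \<in> carrier U \<Longrightarrow> L a \<in> carrier \<A>"
  using \<delta>_lower ideal_vec_lower[OF \<gamma>vec_ideal] unit(1) by (simp_all add: P_def Q_def L_def)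

lemma L_add: "a \<in> carrier U \<Longrightarrow> b \<in> carrier U \<Longrightarrow> L (a \<oplus> b) = L a \<oplus>\<^bsub>\<A>\<^esub> L b"
  by (rule op_eqI) (simp_all add: L_def mult_add_left mult_add_right mult_closed \<delta>_lower)

lemma L_smult: "c \<in> carrier F \<Longrightarrow> a \<in> carrier U \<Longrightarrow> L (c \<odot> a) = c \<odot>\<^bsub>\<A>\<^esub> L a"
  by (rule op_eqI) (simp_all add: L_def mult_smult_left mult_smult_right mult_closed \<delta>_lower)

text \<open>
  Any operator \<open>f\<close> acts between two left multiplications as multiplication by the first component of
  \<open>f \<delta>\<close>, since \<open>\<delta>\<close> generates the first summand as a right module.
\<close>

lemma L_sandwich:
  assumes "a \<in> carrier U" "b \<in> carrier U" "f \<in> carrier \<A>"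
  shows "L a \<otimes>\<^bsub>\<A>\<^esub> f \<otimes>\<^bsub>\<A>\<^esub> L b = L (a \<otimes> f \<delta> None \<otimes> b)"
proof -
  have f\<delta>: "f \<delta> \<in> V_lower" using linear_opD(4)[OF op_linear[OF assms(3)] \<delta>_lower] .
  have "L a \<otimes>\<^bsub>\<A>\<^esub> f \<otimes>\<^bsub>\<A>\<^esub> L b = L a \<otimes>\<^bsub>\<A>\<^esub> (f \<otimes>\<^bsub>\<A>\<^esub> L b)"
    using assms by (intro op.mult_assoc) simp_all
  also have "f \<otimes>\<^bsub>\<A>\<^esub> L b = rank_one (f \<delta>) b None"
    unfolding L_def using assms \<delta>_lower by (intro op_rank_one)
  finally show ?thesis
    using rank_one_mult[OF \<delta>_lower f\<delta> assms(1,2)] by (simp add: L_def)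
qed

lemma L_mult: "a \<in> carrier U \<Longrightarrow> b \<in> carrier U \<Longrightarrow> L a \<otimes>\<^bsub>\<A>\<^esub> L b = L (a \<otimes> b)"
  using rank_one_mult[OF \<delta>_lower \<delta>_lower] unit by (simp add: L_def)

lemma L_inj: "inj_on L (carrier U)"
proof (rule inj_onI)
  fix a b assume "a \<in> carrier U" "b \<in> carrier U" "L a = L b"
  then have "L a \<delta> None = L b \<delta> None" by simp
  then show "a = b" using \<open>a \<in> _\<close> \<open>b \<in> _\<close> unit by (simp add: L_def)
qed

lemma P_sandwich:
  assumes "f \<in> carrier \<A>"
  shows "f \<delta> (Some []) \<in> I" "P \<otimes>\<^bsub>\<A>\<^esub> f \<otimes>\<^bsub>\<A>\<^esub> P = L (f \<delta> (Some [])) \<otimes>\<^bsub>\<A>\<^esub> P"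
proof -
  have f\<delta>: "f \<delta> \<in> V_lower" using linear_opD(4)[OF op_linear[OF assms(1)] \<delta>_lower] .
  then show c: "f \<delta> (Some []) \<in> I" by (simp add: V_lower_def)
  have "P \<otimes>\<^bsub>\<A>\<^esub> f \<otimes>\<^bsub>\<A>\<^esub> P = P \<otimes>\<^bsub>\<A>\<^esub> (f \<otimes>\<^bsub>\<A>\<^esub> P)"
    using assms by (intro op.mult_assoc) simp_all
  also have "f \<otimes>\<^bsub>\<A>\<^esub> P = rank_one (f \<delta>) \<one> (Some [])"
    unfolding P_def using assms \<delta>_lower unit(1) by (intro op_rank_one)
  finally show "P \<otimes>\<^bsub>\<A>\<^esub> f \<otimes>\<^bsub>\<A>\<^esub> P = L (f \<delta> (Some [])) \<otimes>\<^bsub>\<A>\<^esub> P"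
    using rank_one_mult[OF \<delta>_lower f\<delta> unit(1) unit(1)] unit
      rank_one_mult[OF \<delta>_lower \<delta>_lower ideal_in_carrier[OF c] unit(1)] ideal_in_carrier[OF c]
    by (simp add: P_def L_def)
qed

lemma Q_sandwich:
  assumes "f \<in> carrier \<A>"
  shows "f \<gamma>vec None \<in> I" "Q \<otimes>\<^bsub>\<A>\<^esub> f \<otimes>\<^bsub>\<A>\<^esub> Q = Q \<otimes>\<^bsub>\<A>\<^esub> L (f \<gamma>vec None)"
proof -
  have f\<gamma>: "f \<gamma>vec \<in> V_ideal" using linear_opD(5)[OF op_linear[OF assms(1)] \<gamma>vec_ideal] .
  then show c: "f \<gamma>vec None \<in> I" by (simp add: V_ideal_def)
  note low = ideal_vec_lower[OF \<gamma>vec_ideal]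
  have "Q \<otimes>\<^bsub>\<A>\<^esub> f \<otimes>\<^bsub>\<A>\<^esub> Q = Q \<otimes>\<^bsub>\<A>\<^esub> (f \<otimes>\<^bsub>\<A>\<^esub> Q)"
    using assms by (intro op.mult_assoc) simp_all
  also have "f \<otimes>\<^bsub>\<A>\<^esub> Q = rank_one (f \<gamma>vec) \<one> None"
    unfolding Q_def using assms low unit(1) by (intro op_rank_one)
  finally show "Q \<otimes>\<^bsub>\<A>\<^esub> f \<otimes>\<^bsub>\<A>\<^esub> Q = Q \<otimes>\<^bsub>\<A>\<^esub> L (f \<gamma>vec None)"
    using rank_one_mult[OF low ideal_vec_lower[OF f\<gamma>] unit(1) unit(1)] unit
      rank_one_mult[OF low \<delta>_lower unit(1) ideal_in_carrier[OF c]] ideal_in_carrier[OF c]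
    by (simp add: Q_def L_def)
qed

text \<open>
  This puts the left multiplications by the values of \<open>\<gamma>\<close> into \<open>E\<close>.
\<close>

lemma P_shift_Q: "P \<otimes>\<^bsub>\<A>\<^esub> (shift w \<otimes>\<^bsub>\<A>\<^esub> Q) = L (\<gamma> w)"
proof -
  note low = ideal_vec_lower[OF \<gamma>vec_ideal]
  have low': "shift w \<gamma>vec \<in> V_lower" using linear_opD(4)[OF op_linear[OF shift_closed] low] .
  have "shift w \<otimes>\<^bsub>\<A>\<^esub> Q = rank_one (shift w \<gamma>vec) \<one> None"
    unfolding Q_def using low unit(1) by (intro op_rank_one) simp_all
  then show ?thesis
    using rank_one_mult[OF \<delta>_lower low' unit(1) unit(1)] unit by (simp add: P_def L_def)
qed

lemma shift_mult: "shift u \<otimes>\<^bsub>\<A>\<^esub> shift w = shift (u @ w)"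
proof (rule op_eqI)
  show "(shift u \<otimes>\<^bsub>\<A>\<^esub> shift w) v i = shift (u @ w) v i" if v: "v \<in> V" for v i
  proof -
    have "shift w v \<in> V" using v by (rule op_V[OF shift_closed])
    then show ?thesis using v by (cases i) (simp_all add: shift_def)
  qed
qed simp_all

definition generators :: "('c vec \<Rightarrow> 'c vec) set" where
  "generators = insert P (insert Q (range (\<lambda>i. shift [i])))"

definition E :: "('c vec \<Rightarrow> 'c vec) set" where
  "E = generated_subalgebra F \<A> generators"

definition E_unital :: "('c vec \<Rightarrow> 'c vec) set" where
  "E_unital = generated_subalgebra F \<A> (insert \<one>\<^bsub>\<A>\<^esub> generators)"

lemma generators_carrier: "generators \<subseteq> carrier \<A>" "finite generators"
  by (auto simp: generators_def)

lemma E_subalgebra: "assoc_subalgebra F E \<A>"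
  unfolding E_def using generators_carrier(1) by (rule op.generated_subalgebra_subalgebra)

lemma E_unital_subalgebra: "assoc_subalgebra F E_unital \<A>"
  unfolding E_unital_def using generators_carrier(1) by (intro op.generated_subalgebra_subalgebra) simp

lemmas E_closed = op.assoc_subalgebraD[OF E_subalgebra]
lemmas E_unital_closed = op.assoc_subalgebraD[OF E_unital_subalgebra]

lemma generators_E: "generators \<subseteq> E"
  unfolding E_def by (rule op.generated_subalgebra_superset)

lemma generators_E_unital: "insert \<one>\<^bsub>\<A>\<^esub> generators \<subseteq> E_unital"
  unfolding E_unital_def by (rule op.generated_subalgebra_superset)

lemma E_subset: "E \<subseteq> E_unital"
  unfolding E_def using E_unital_subalgebra generators_E_unital
  by (intro op.generated_subalgebra_least) auto

lemma op_one [simp]: "f \<in> carrier \<A> \<Longrightarrow> \<one>\<^bsub>\<A>\<^esub> \<otimes>\<^bsub>\<A>\<^esub> f = f" "f \<in> carrier \<A> \<Longrightarrow> f \<otimes>\<^bsub>\<A>\<^esub> \<one>\<^bsub>\<A>\<^esub> = f"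
  by (rule op_eqI; simp)+

lemma E_right_ideal:
  assumes x: "x \<in> E" and y: "y \<in> E_unital"
  shows "x \<otimes>\<^bsub>\<A>\<^esub> y \<in> E"
proof -
  have "assoc_subalgebra F {y \<in> carrier \<A>. \<forall>x\<in>E. x \<otimes>\<^bsub>\<A>\<^esub> y \<in> E} \<A>"
  proof (rule op.assoc_subalgebraI)
    fix y z assume yz: "y \<in> {y \<in> carrier \<A>. \<forall>x\<in>E. x \<otimes>\<^bsub>\<A>\<^esub> y \<in> E}" "z \<in> {y \<in> carrier \<A>. \<forall>x\<in>E. x \<otimes>\<^bsub>\<A>\<^esub> y \<in> E}"
    have "x \<otimes>\<^bsub>\<A>\<^esub> (y \<otimes>\<^bsub>\<A>\<^esub> z) \<in> E" if "x \<in> E" for x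
    proof -
      have "x \<in> carrier \<A>" using that E_closed(1) by blast
      then have "x \<otimes>\<^bsub>\<A>\<^esub> (y \<otimes>\<^bsub>\<A>\<^esub> z) = (x \<otimes>\<^bsub>\<A>\<^esub> y) \<otimes>\<^bsub>\<A>\<^esub> z"
        using yz by (simp add: op.mult_assoc)
      then show ?thesis using yz that by simp
    qed
    then show "y \<otimes>\<^bsub>\<A>\<^esub> z \<in> {y \<in> carrier \<A>. \<forall>x\<in>E. x \<otimes>\<^bsub>\<A>\<^esub> y \<in> E}" using yz by auto
  qed (use E_closed in \<open>auto simp: op.mult_add_right op.mult_smult_right subset_iff\<close>)
  moreover have "insert \<one>\<^bsub>\<A>\<^esub> generators \<subseteq> {y \<in> carrier \<A>. \<forall>x\<in>E. x \<otimes>\<^bsub>\<A>\<^esub> y \<in> E}"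
    using E_closed(1,5) generators_carrier generators_E by auto
  ultimately have "E_unital \<subseteq> {y \<in> carrier \<A>. \<forall>x\<in>E. x \<otimes>\<^bsub>\<A>\<^esub> y \<in> E}"
    unfolding E_unital_def by (rule op.generated_subalgebra_least)
  then show ?thesis using x y by auto
qed

lemma shift_E: "w \<noteq> [] \<Longrightarrow> shift w \<in> E"
proof (induction w)
  case (Cons i w)
  have i: "shift [i] \<in> E" using generators_E by (auto simp: generators_def)
  show ?case
  proof (cases "w = []")
    case False
    then show ?thesis using Cons.IH E_closed(5)[OF i, of "shift w"] by (simp add: shift_mult)
  qed (use i in simp)
qed simp

lemma PQ_E: "P \<in> E" "Q \<in> E"
  using generators_E by (auto simp: generators_def)

lemma L_\<gamma>_E: "w \<noteq> [] \<Longrightarrow> L (\<gamma> w) \<in> E"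
  unfolding P_shift_Q[symmetric] using PQ_E shift_E by (intro E_closed(5))

end

section \<open>The algebra of operators is radical\<close>

context wreath
begin

sublocale RE: ring "\<A>\<lparr>carrier := E_unital\<rparr>"
proof -
  interpret RE: assoc_algebra F "\<A>\<lparr>carrier := E_unital\<rparr>"
    using E_unital_subalgebra by (rule op.assoc_subalgebra_algebra)
  show "ring (\<A>\<lparr>carrier := E_unital\<rparr>)"
    using E_unital_closed(1) generators_E_unital by (intro RE.unital_ring) (auto simp: subset_iff)
qed

lemma L_E: "a \<in> I \<Longrightarrow> L a \<in> E"
proof -
  assume a: "a \<in> I"
  have "L \<zero> = \<zero>\<^bsub>\<A>\<^esub>" by (rule op_eqI) (simp_all add: L_def \<delta>_lower)
  then have "submodule F {a \<in> carrier U. L a \<in> E} U"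
    using E_closed by (intro submodule_criterion) (auto simp: L_add L_smult)
  moreover have "\<gamma> ` {w. w \<noteq> []} \<subseteq> {a \<in> carrier U. L a \<in> E}" using L_\<gamma>_E by auto
  ultimately have "span (\<gamma> ` {w. w \<noteq> []}) \<subseteq> {a \<in> carrier U. L a \<in> E}"
    by (intro span_is_subset)
  then show ?thesis using a \<gamma>_spans by blast
qed

text \<open>
  For \<open>k = L a r\<close> the sandwich identity turns products \<open>k L b\<close> into \<open>L (s b)\<close> with \<open>s\<close> in \<open>I\<close>. A
  quasi-inverse of \<open>s\<close> then yields a right inverse of \<open>1 - k\<close>.
\<close>

lemma L_radical:
  assumes a: "a \<in> I"
  shows "L a \<in> RE.unital_radical"
proof -
  have ac: "a \<in> carrier U" using a by (rule ideal_in_carrier)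
  have "RE.right_invertible (\<one>\<^bsub>\<A>\<lparr>carrier := E_unital\<rparr>\<^esub> \<ominus>\<^bsub>\<A>\<lparr>carrier := E_unital\<rparr>\<^esub> L a \<otimes>\<^bsub>\<A>\<^esub> r)"
    if r: "r \<in> E_unital" for r
  proof -
    have rc: "r \<in> carrier \<A>" using r E_unital_closed(1) by blast
    define s where "s = a \<otimes> r \<delta> None"
    have r\<delta>: "r \<delta> None \<in> carrier U" using rc by simp
    have s: "s \<in> I" unfolding s_def using a r\<delta> by (rule ideal_right)
    obtain s' where s': "s' \<in> I" "s \<oplus> s' \<ominus> s \<otimes> s' = \<zero>" using quasi_inverse[OF s] by blast
    note sc = ideal_in_carrier[OF s] ideal_in_carrier[OF s'(1)]
    have ss': "s \<otimes> s' = s \<oplus> s'"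
      using s'(2) sc by (simp add: mult_closed M.minus_eq) (metis M.add.m_closed M.add.inv_closed
        M.minus_equality M.minus_minus mult_closed)
    let ?k = "L a \<otimes>\<^bsub>\<A>\<^esub> r"
    have kl: "?k \<otimes>\<^bsub>\<A>\<^esub> L b = L (s \<otimes> b)" if "b \<in> carrier U" for b
      unfolding s_def using ac that rc by (rule L_sandwich)
    have "?k \<otimes>\<^bsub>\<A>\<^esub> ?k = ?k \<otimes>\<^bsub>\<A>\<^esub> L a \<otimes>\<^bsub>\<A>\<^esub> r"
      using rc ac by (intro op.mult_assoc[symmetric]) simp_all
    also have "?k \<otimes>\<^bsub>\<A>\<^esub> L a = L s \<otimes>\<^bsub>\<A>\<^esub> L a"
      using ac sc by (simp only: kl L_mult)
    also have "L s \<otimes>\<^bsub>\<A>\<^esub> L a \<otimes>\<^bsub>\<A>\<^esub> r = L s \<otimes>\<^bsub>\<A>\<^esub> ?k"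
      using rc ac sc by (intro op.mult_assoc) simp_all
    finally have kk: "?k \<otimes>\<^bsub>\<A>\<^esub> ?k = L s \<otimes>\<^bsub>\<A>\<^esub> ?k" .
    have "L a \<in> E_unital" "L s \<in> E_unital" "L s' \<in> E_unital"
      using L_E a s s' E_subset by auto
    then show ?thesis
      using r E_unital_closed(5) kk kl sc
      by (intro RE.right_invertible_one_minus[of _ "L s" "L s'"])
        (simp_all add: L_mult ss' L_add)
  qed
  then show ?thesis using L_E[OF a] E_subset by (auto simp: RE.unital_radical_def)
qed

lemma P_radical: "P \<in> RE.unital_radical"
proof (rule RE.unital_radical_semiprime)
  show P: "P \<in> carrier (\<A>\<lparr>carrier := E_unital\<rparr>)" using PQ_E E_subset by auto
  fix r assume "r \<in> carrier (\<A>\<lparr>carrier := E_unital\<rparr>)"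
  then have "r \<in> carrier \<A>" using E_unital_closed(1) by auto
  from P_sandwich[OF this] show "P \<otimes>\<^bsub>\<A>\<lparr>carrier := E_unital\<rparr>\<^esub> r \<otimes>\<^bsub>\<A>\<lparr>carrier := E_unital\<rparr>\<^esub> P
      \<in> RE.unital_radical"
    using RE.unital_radical_right[OF L_radical P] by simp
qed

lemma Q_radical: "Q \<in> RE.unital_radical"
proof (rule RE.unital_radical_semiprime)
  show Q: "Q \<in> carrier (\<A>\<lparr>carrier := E_unital\<rparr>)" using PQ_E E_subset by auto
  fix r assume "r \<in> carrier (\<A>\<lparr>carrier := E_unital\<rparr>)"
  then have "r \<in> carrier \<A>" using E_unital_closed(1) by auto
  from Q_sandwich[OF this] show "Q \<otimes>\<^bsub>\<A>\<lparr>carrier := E_unital\<rparr>\<^esub> r \<otimes>\<^bsub>\<A>\<lparr>carrier := E_unital\<rparr>\<^esub> Q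
      \<in> RE.unital_radical"
    using RE.unital_radical_left[OF L_radical Q] by simp
qed

definition shifts :: "('c vec \<Rightarrow> 'c vec) set" where "shifts = shift ` {w. w \<noteq> []}"

lemma shifts_carrier: "shifts \<subseteq> carrier \<A>" by (auto simp: shifts_def)

lemma shifts_span_E_unital: "op.span shifts \<subseteq> E_unital"
  using shift_E E_subset E_unital_subalgebra
  by (intro op.span_is_subset) (auto simp: shifts_def assoc_subalgebra_def VectorSpace.subspace_def)

text \<open>
  The sums of the two kinds form a subalgebra that contains all generators: shifts by nonempty words
  multiply among themselves, \<open>P\<close> and \<open>Q\<close> lie in the radical, and the radical is an ideal.
\<close>

lemma E_decomposition:
  assumes "x \<in> E"
  obtains b j where "b \<in> op.span shifts" "j \<in> RE.unital_radical" "x = b \<oplus>\<^bsub>\<A>\<^esub> j"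
proof -
  let ?B = "op.span shifts" and ?J = "RE.unital_radical"
  have Bsub: "assoc_subalgebra F ?B \<A>"
  proof (rule op.span_mult_closed[OF shifts_carrier])
    show "s \<otimes>\<^bsub>\<A>\<^esub> t \<in> shifts" if "s \<in> shifts" "t \<in> shifts" for s t
      using that by (force simp: shifts_def shift_mult)
  qed
  note B = op.assoc_subalgebraD[OF Bsub]
  have BE: "?B \<subseteq> E_unital" by (rule shifts_span_E_unital)
  have JE: "?J \<subseteq> E_unital" using RE.unital_radicalD(1) by auto
  have JC: "?J \<subseteq> carrier \<A>" using JE E_unital_closed(1) by blast
  have J0: "\<zero>\<^bsub>\<A>\<^esub> \<in> ?J" using RE.unital_radical_zero by simp
  have Jadd: "i \<oplus>\<^bsub>\<A>\<^esub> j \<in> ?J" if "i \<in> ?J" "j \<in> ?J" for i j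
    using RE.unital_radical_add[OF that] by simp
  have Jl: "r \<otimes>\<^bsub>\<A>\<^esub> j \<in> ?J" if "r \<in> E_unital" "j \<in> ?J" for r j
    using RE.unital_radical_left[OF that(2)] that(1) by simp
  have Jr: "j \<otimes>\<^bsub>\<A>\<^esub> r \<in> ?J" if "r \<in> E_unital" "j \<in> ?J" for r j
    using RE.unital_radical_right[OF that(2)] that(1) by simp
  have Jsm: "c \<odot>\<^bsub>\<A>\<^esub> j \<in> ?J" if "c \<in> carrier F" "j \<in> ?J" for c j
  proof -
    have "c \<odot>\<^bsub>\<A>\<^esub> \<one>\<^bsub>\<A>\<^esub> \<in> E_unital"
      using that(1) generators_E_unital E_unital_closed(4) by blast
    then have "(c \<odot>\<^bsub>\<A>\<^esub> \<one>\<^bsub>\<A>\<^esub>) \<otimes>\<^bsub>\<A>\<^esub> j \<in> ?J" using that(2) by (rule Jl)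
    moreover have "j \<in> carrier \<A>" using that(2) JC by blast
    ultimately show ?thesis using that(1) by (simp add: op.mult_smult_left)
  qed
  define T where "T = {x. \<exists>b\<in>?B. \<exists>j\<in>?J. x = b \<oplus>\<^bsub>\<A>\<^esub> j}"
  have TI: "b \<oplus>\<^bsub>\<A>\<^esub> j \<in> T" if "b \<in> ?B" "j \<in> ?J" for b j using that by (auto simp: T_def)
  have "assoc_subalgebra F T \<A>"
  proof (rule op.assoc_subalgebraI)
    show "T \<subseteq> carrier \<A>" using B(1) JC by (auto simp: T_def subset_iff)
    show "\<zero>\<^bsub>\<A>\<^esub> \<in> T" using TI[OF B(2) J0] by simp
  next
    fix x y assume "x \<in> T" "y \<in> T"
    then obtain b j b' j' where x: "b \<in> ?B" "j \<in> ?J" "x = b \<oplus>\<^bsub>\<A>\<^esub> j"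
      and y: "b' \<in> ?B" "j' \<in> ?J" "y = b' \<oplus>\<^bsub>\<A>\<^esub> j'" by (auto simp: T_def)
    have c: "b \<in> carrier \<A>" "j \<in> carrier \<A>" "b' \<in> carrier \<A>" "j' \<in> carrier \<A>"
      using x y B(1) JC by auto
    have "x \<oplus>\<^bsub>\<A>\<^esub> y = (b \<oplus>\<^bsub>\<A>\<^esub> b') \<oplus>\<^bsub>\<A>\<^esub> (j \<oplus>\<^bsub>\<A>\<^esub> j')"
      using c x(3) y(3) by (simp add: op.M.a_ac)
    then show "x \<oplus>\<^bsub>\<A>\<^esub> y \<in> T" using TI[OF B(3)[OF x(1) y(1)] Jadd[OF x(2) y(2)]] by simp
    have "x \<otimes>\<^bsub>\<A>\<^esub> y = b \<otimes>\<^bsub>\<A>\<^esub> b' \<oplus>\<^bsub>\<A>\<^esub> (b \<otimes>\<^bsub>\<A>\<^esub> j' \<oplus>\<^bsub>\<A>\<^esub> j \<otimes>\<^bsub>\<A>\<^esub> (b' \<oplus>\<^bsub>\<A>\<^esub> j'))"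
      using c x(3) y(3) by (simp add: op.mult_add_left op.mult_add_right op.M.a_ac)
    moreover have "b \<otimes>\<^bsub>\<A>\<^esub> j' \<in> ?J" using BE x(1) y(2) by (intro Jl) auto
    moreover have "j \<otimes>\<^bsub>\<A>\<^esub> (b' \<oplus>\<^bsub>\<A>\<^esub> j') \<in> ?J"
      using BE JE x(2) y(1,2) E_unital_closed(3) by (intro Jr) auto
    ultimately show "x \<otimes>\<^bsub>\<A>\<^esub> y \<in> T" using TI[OF B(5)[OF x(1) y(1)]] Jadd by simp
  next
    fix c x assume c: "c \<in> carrier F" and "x \<in> T"
    then obtain b j where x: "b \<in> ?B" "j \<in> ?J" "x = b \<oplus>\<^bsub>\<A>\<^esub> j" by (auto simp: T_def)
    have "c \<odot>\<^bsub>\<A>\<^esub> x = c \<odot>\<^bsub>\<A>\<^esub> b \<oplus>\<^bsub>\<A>\<^esub> c \<odot>\<^bsub>\<A>\<^esub> j"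
      using c x B(1) JC by (auto simp: op.smult_r_distr subset_iff)
    then show "c \<odot>\<^bsub>\<A>\<^esub> x \<in> T" using TI[OF B(4)[OF c x(1)] Jsm[OF c x(2)]] by simp
  qed
  moreover have "generators \<subseteq> T"
  proof -
    have "P \<in> T" using TI[OF B(2) P_radical] by simp
    moreover have "Q \<in> T" using TI[OF B(2) Q_radical] by simp
    moreover have "shift [i] \<in> T" for i
    proof -
      have "shift [i] \<in> ?B" using op.in_own_span[OF shifts_carrier] by (auto simp: shifts_def)
      from TI[OF this J0] show ?thesis by simp
    qed
    ultimately show ?thesis by (auto simp: generators_def)
  qed
  ultimately have "E \<subseteq> T" unfolding E_def by (rule op.generated_subalgebra_least)
  then show ?thesis using assms that by (auto simp: T_def)
qed

lemma finsum_op_apply: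
  assumes "finite W" "\<And>u. u \<in> W \<Longrightarrow> f u \<in> carrier \<A>" "v \<in> V"
  shows "(\<Oplus>\<^bsub>\<A>\<^esub>u\<in>W. f u) v i = (\<Oplus>u\<in>W. f u v i)"
  using assms(1,2)
proof (induction W rule: finite_induct)
  case (insert w W)
  then show ?case
    using assms(3) by (simp add: op.M.finsum_insert M.finsum_insert Pi_iff op.M.finsum_closed)
qed (use assms(3) in simp)

definition lists_over :: "letter list set \<Rightarrow> nat \<Rightarrow> letter list list set" where
  "lists_over W N = {us. set us \<subseteq> W \<and> length us = N}"

text \<open>
  The value at \<open>t\<close> of the commutative monomial with exponents \<open>m\<close>. It depends on a list of words only
  through its multiset, which is why the terms of a power can be grouped by multisets.
\<close>

definition monomial_coeff :: "letter list set \<Rightarrow> (letter list \<Rightarrow> 'a) \<Rightarrow> letter list multiset \<Rightarrow> 'a" where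
  "monomial_coeff W t m = (\<Otimes>\<^bsub>F\<^esub>u\<in>W. t u [^]\<^bsub>F\<^esub> count m u)"

lemma monomial_coeff_closed:
  "t \<in> W \<rightarrow> carrier F \<Longrightarrow> monomial_coeff W t m \<in> carrier F"
  unfolding monomial_coeff_def by (rule R.finprod_closed) auto

lemma monomial_coeff_add:
  assumes "finite W" "u \<in> W" "t \<in> W \<rightarrow> carrier F"
  shows "monomial_coeff W t (add_mset u m) = monomial_coeff W t m \<otimes>\<^bsub>F\<^esub> t u"
proof -
  have tc: "t w \<in> carrier F" if "w \<in> W" for w using assms(3) that by blast
  have "monomial_coeff W t (add_mset u m)
      = (\<Otimes>\<^bsub>F\<^esub>w\<in>W. t w [^]\<^bsub>F\<^esub> count m w \<otimes>\<^bsub>F\<^esub> (if u = w then t w else \<one>\<^bsub>F\<^esub>))"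
    unfolding monomial_coeff_def using tc by (intro R.finprod_cong') auto
  also have "\<dots> = monomial_coeff W t m \<otimes>\<^bsub>F\<^esub> (\<Otimes>\<^bsub>F\<^esub>w\<in>W. if u = w then t w else \<one>\<^bsub>F\<^esub>)"
    unfolding monomial_coeff_def using tc by (intro R.finprod_multf) auto
  also have "(\<Otimes>\<^bsub>F\<^esub>w\<in>W. if u = w then t w else \<one>\<^bsub>F\<^esub>) = t u"
    using assms(2,1,3) by (rule R.finprod_singleton)
  finally show ?thesis .
qed

lemma finite_lists_over: "finite W \<Longrightarrow> finite (lists_over W N)"
  unfolding lists_over_def by (rule finite_lists_length_eq)

text \<open>
  By induction on \<open>N\<close>: the factor that is applied first contributes the last word of each list.
\<close>

lemma shift_combination_power:
  assumes W: "finite W" and t: "t \<in> W \<rightarrow> carrier F" and b: "b \<in> E_unital"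
    and apply_b: "\<And>v z. v \<in> V \<Longrightarrow> b v (Some z) = (\<Oplus>u\<in>W. t u \<odot> v (Some (z @ u)))"
    and v: "v \<in> V"
  shows "(b [^]\<^bsub>\<A>\<lparr>carrier := E_unital\<rparr>\<^esub> (N::nat)) v (Some z)
    = (\<Oplus>us\<in>lists_over W N. monomial_coeff W t (mset us) \<odot> v (Some (z @ concat us)))"
  using v
proof (induction N arbitrary: v)
  case 0
  have "lists_over W 0 = {[]}" by (auto simp: lists_over_def)
  moreover have "monomial_coeff W t {#} = \<one>\<^bsub>F\<^esub>"
    unfolding monomial_coeff_def by (simp add: R.finprod_one_eqI)
  ultimately show ?case using 0 by (simp add: M.finsum_insert)
next
  case (Suc N)
  have bc: "b \<in> carrier \<A>" using b E_unital_closed(1) by blast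
  have bv: "b v \<in> V" using bc Suc.prems by simp
  note mc = monomial_coeff_closed[OF t]
  have "(b [^]\<^bsub>\<A>\<lparr>carrier := E_unital\<rparr>\<^esub> Suc N) v (Some z)
    = (\<Oplus>us\<in>lists_over W N. monomial_coeff W t (mset us) \<odot> b v (Some (z @ concat us)))"
    using Suc.IH[OF bv] Suc.prems by simp
  also have "\<dots> = (\<Oplus>us\<in>lists_over W N. \<Oplus>u\<in>W.
      monomial_coeff W t (mset (us @ [u])) \<odot> v (Some (z @ concat (us @ [u]))))"
  proof (rule M.finsum_cong')
    show "(\<lambda>us. \<Oplus>u\<in>W. monomial_coeff W t (mset (us @ [u])) \<odot> v (Some (z @ concat (us @ [u]))))
        \<in> lists_over W N \<rightarrow> carrier U"
      using Suc.prems mc by (auto intro!: M.finsum_closed)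
    fix us assume "us \<in> lists_over W N"
    have "monomial_coeff W t (mset us) \<odot> b v (Some (z @ concat us))
      = (\<Oplus>u\<in>W. monomial_coeff W t (mset us) \<odot> (t u \<odot> v (Some (z @ concat us @ u))))"
      using Suc.prems t mc W by (subst apply_b) (auto intro!: finsum_smult_ldistr)
    also have "\<dots> = (\<Oplus>u\<in>W. monomial_coeff W t (mset (us @ [u])) \<odot> v (Some (z @ concat (us @ [u]))))"
    proof (rule M.finsum_cong')
      show "monomial_coeff W t (mset us) \<odot> (t u \<odot> v (Some (z @ concat us @ u)))
        = monomial_coeff W t (mset (us @ [u])) \<odot> v (Some (z @ concat (us @ [u])))" if u: "u \<in> W" for u
      proof -
        have "t u \<in> carrier F" using t u by blast
        then show ?thesis
          using Suc.prems mc monomial_coeff_add[OF W u t] by (simp add: smult_assoc1)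
      qed
    qed (use Suc.prems mc in auto)
    finally show "monomial_coeff W t (mset us) \<odot> b v (Some (z @ concat us))
      = (\<Oplus>u\<in>W. monomial_coeff W t (mset (us @ [u])) \<odot> v (Some (z @ concat (us @ [u]))))" .
  qed simp
  also have "\<dots> = finsum U (\<lambda>(us, u). monomial_coeff W t (mset (us @ [u])) \<odot>
      v (Some (z @ concat (us @ [u])))) (lists_over W N \<times> W)"
    using Suc.prems mc W finite_lists_over[OF W] by (intro M.add.finprod_finprod) simp_all
  also have "\<dots> = (\<Oplus>p\<in>lists_over W N \<times> W. monomial_coeff W t (mset (fst p @ [snd p]))
      \<odot> v (Some (z @ concat (fst p @ [snd p]))))"
    by (simp only: case_prod_beta')
  also have "\<dots> = (\<Oplus>us\<in>(\<lambda>p. fst p @ [snd p]) ` (lists_over W N \<times> W).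
      monomial_coeff W t (mset us) \<odot> v (Some (z @ concat us)))"
    using Suc.prems mc by (intro M.finsum_reindex[symmetric]) (auto simp: inj_on_def)
  also have "(\<lambda>p. fst p @ [snd p]) ` (lists_over W N \<times> W) = lists_over W (Suc N)"
  proof
    show "lists_over W (Suc N) \<subseteq> (\<lambda>p. fst p @ [snd p]) ` (lists_over W N \<times> W)"
    proof
      fix us assume us: "us \<in> lists_over W (Suc N)"
      then obtain vs u where "us = vs @ [u]" by (cases us rule: rev_cases) (auto simp: lists_over_def)
      with us show "us \<in> (\<lambda>p. fst p @ [snd p]) ` (lists_over W N \<times> W)"
        by (intro image_eqI[of _ _ "(vs, u)"]) (auto simp: lists_over_def)
    qed
  qed (auto simp: lists_over_def)
  finally show ?case .
qed

text \<open>
  The expansion of the power is grouped by the multisets of words. Each group is a scalar times the sum over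
  all arrangements of one multiset, and this is a relation if the exponent is \<open>nil_exponent D\<close> for a bound
  \<open>D\<close> on the lengths of the words. The component at \<open>None\<close> vanishes after one step.
\<close>

lemma shift_span_nil:
  assumes "b \<in> op.span shifts"
  shows "\<exists>N::nat. b [^]\<^bsub>\<A>\<lparr>carrier := E_unital\<rparr>\<^esub> N = \<zero>\<^bsub>\<A>\<^esub>"
proof -
  let ?RE = "\<A>\<lparr>carrier := E_unital\<rparr>"
  obtain a B where B: "finite B" "B \<subseteq> shifts" "a \<in> B \<rightarrow> carrier F" "b = op.lincomb a B"
    using assms unfolding op.span_def by blast
  have "\<exists>W\<subseteq>{w. w \<noteq> []}. inj_on shift W \<and> B = shift ` W"
    using B(2) unfolding shifts_def by (simp only: subset_image_inj)
  then obtain W where W': "W \<subseteq> {w. w \<noteq> []}" "B = shift ` W" "inj_on shift W" by blast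
  have "finite W" using B(1) W'(2,3) finite_imageD by blast
  note W = this W'
  define t where "t u = a (shift u)" for u
  have t: "t \<in> W \<rightarrow> carrier F" using B(3) W(3) by (auto simp: t_def)
  have b_sum: "b = (\<Oplus>\<^bsub>\<A>\<^esub>u\<in>W. t u \<odot>\<^bsub>\<A>\<^esub> shift u)"
    unfolding B(4) op.lincomb_def W(3) t_def
  proof (rule op.M.finsum_reindex[OF _ W(4)])
    show "(\<lambda>f. a f \<odot>\<^bsub>\<A>\<^esub> f) \<in> shift ` W \<rightarrow> carrier \<A>"
    proof
      fix f assume "f \<in> shift ` W"
      moreover from this have "a f \<in> carrier F" using B(3) W(3) by blast
      ultimately show "a f \<odot>\<^bsub>\<A>\<^esub> f \<in> carrier \<A>" by auto
    qed
  qed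
  have b_apply: "b v i = (\<Oplus>u\<in>W. t u \<odot> shift u v i)" if "v \<in> V" for v i
  proof -
    have "b v i = (\<Oplus>u\<in>W. (t u \<odot>\<^bsub>\<A>\<^esub> shift u) v i)"
      unfolding b_sum
    proof (rule finsum_op_apply[OF W(1) _ that])
      show "t u \<odot>\<^bsub>\<A>\<^esub> shift u \<in> carrier \<A>" if "u \<in> W" for u
        using t that by (intro op_closed(5)) auto
    qed
    then show ?thesis using that by (simp del: shift_apply)
  qed
  have bE: "b \<in> E_unital" using assms shifts_span_E_unital by blast
  have b_Some: "b v (Some z) = (\<Oplus>u\<in>W. t u \<odot> v (Some (z @ u)))" if "v \<in> V" for v z
    using b_apply[OF that] that by simp
  have b_None: "b v None = \<zero>" if "v \<in> V" for v
    unfolding b_apply[OF that]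
  proof (rule U.finsum_zero_cong)
    fix u assume "u \<in> W"
    then have "t u \<in> carrier F" using t by blast
    then show "t u \<odot> shift u v None = \<zero>" using that by simp
  qed
  \<comment> \<open>The sum of the lengths is a bound for each of them.\<close>
  define D where "D = (\<Sum>u\<in>W. length u)"
  have WD: "W \<subseteq> short_words D"
    using W(1,2) by (auto simp: short_words_def D_def intro: member_le_sum)
  define N where "N = nil_exponent D"
  obtain N' where N': "N = Suc N'" using nil_exponent_gt[of D] unfolding N_def by (cases "nil_exponent D") auto
  define M where "M = {m. size m = N \<and> set_mset m \<subseteq> W}"
  have MR: "M \<subseteq> relators D" using WD by (auto simp: M_def relators_def N_def)
  have bN: "b [^]\<^bsub>?RE\<^esub> n \<in> E_unital" for n :: nat
    using RE.nat_pow_closed[of b n] bE by simp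
  then have bNc: "b [^]\<^bsub>?RE\<^esub> n \<in> carrier \<A>" for n :: nat
    using E_unital_closed(1) by blast
  have "b [^]\<^bsub>?RE\<^esub> N = \<zero>\<^bsub>\<A>\<^esub>"
  proof (rule op_eqI[OF bNc])
    fix v i assume v: "v \<in> V"
    show "(b [^]\<^bsub>?RE\<^esub> N) v i = \<zero>\<^bsub>\<A>\<^esub> v i"
    proof (cases i)
      case None
      have "b [^]\<^bsub>?RE\<^esub> N = b \<otimes>\<^bsub>\<A>\<^esub> (b [^]\<^bsub>?RE\<^esub> N')"
        unfolding N' using RE.nat_pow_Suc2[of b N'] bE by simp
      then show ?thesis using v None b_None[OF op_V[OF bNc v]] by simp
    next
      case (Some z)
      have "lists_over W N = (\<Union>m\<in>M. {us. mset us = m})"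
        by (auto simp: lists_over_def M_def)
      then have "(b [^]\<^bsub>?RE\<^esub> N) v i
        = (\<Oplus>us\<in>(\<Union>m\<in>M. {us. mset us = m}). monomial_coeff W t (mset us) \<odot> v (Some (z @ concat us)))"
        using shift_combination_power[OF W(1) t bE b_Some v] Some by simp
      also have "\<dots> = (\<Oplus>m\<in>M. \<Oplus>us\<in>{us. mset us = m}. monomial_coeff W t (mset us) \<odot> v (Some (z @ concat us)))"
        using MR v monomial_coeff_closed[OF t]
        by (intro M.add.finprod_UN_disjoint) (auto simp: pairwise_def disjnt_def intro: finite_subset)
      also have "\<dots> = \<zero>"
      proof (rule U.finsum_zero_cong)
        fix m assume "m \<in> M"
        then have m: "m \<in> relators D" using MR by blast
        have "(\<Oplus>us\<in>{us. mset us = m}. monomial_coeff W t (mset us) \<odot> v (Some (z @ concat us)))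
          = (\<Oplus>us\<in>{us. mset us = m}. monomial_coeff W t m \<odot> v (Some (z @ concat us)))"
          using v monomial_coeff_closed[OF t] by (intro M.finsum_cong') auto
        also have "\<dots> = monomial_coeff W t m \<odot> (\<Oplus>us\<in>{us. mset us = m}. v (Some (z @ concat us)))"
          using v monomial_coeff_closed[OF t] by (intro finsum_smult_ldistr[symmetric]) auto
        also have "(\<Oplus>us\<in>{us. mset us = m}. v (Some (z @ concat us @ []))) = \<zero>"
          using v m unfolding V_def annihilates_relators_def by blast
        then have "(\<Oplus>us\<in>{us. mset us = m}. v (Some (z @ concat us))) = \<zero>" by simp
        finally show "(\<Oplus>us\<in>{us. mset us = m}. monomial_coeff W t (mset us) \<odot> v (Some (z @ concat us))) = \<zero>"
          using monomial_coeff_closed[OF t] by simp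
      qed
      finally show ?thesis using v Some by simp
    qed
  qed simp
  then show ?thesis by blast
qed

theorem E_algebra: "assoc_algebra F (\<A>\<lparr>carrier := E\<rparr>)"
  using E_subalgebra by (rule op.assoc_subalgebra_algebra)

theorem E_finitely_generated: "finitely_generated_algebra F (\<A>\<lparr>carrier := E\<rparr>)"
  unfolding E_def using generators_carrier(2,1) by (rule op.finitely_generated_generated_subalgebra)

text \<open>
  If \<open>y\<close> is a right inverse of \<open>1 - x\<close> in the unital hull, then \<open>1 - y = - x y\<close> is a right
  quasi-inverse of \<open>x\<close>, and it lies in \<open>E\<close> because \<open>E\<close> is a right ideal of its unital hull.
\<close>

theorem E_radical: "is_jacobson_radical (\<A>\<lparr>carrier := E\<rparr>)"
proof -
  interpret E: assoc_algebra F "\<A>\<lparr>carrier := E\<rparr>" by (rule E_algebra)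
  let ?RE = "\<A>\<lparr>carrier := E_unital\<rparr>"
  show ?thesis
  proof (rule E.is_jacobson_radical_right)
    fix x assume "x \<in> carrier (\<A>\<lparr>carrier := E\<rparr>)"
    then have x: "x \<in> E" "x \<in> E_unital" "x \<in> carrier \<A>"
      using E_subset E_closed(1) by auto
    obtain b j where bj: "b \<in> op.span shifts" "j \<in> RE.unital_radical" "x = b \<oplus>\<^bsub>\<A>\<^esub> j"
      using E_decomposition[OF x(1)] by blast
    obtain N :: nat where "b [^]\<^bsub>?RE\<^esub> N = \<zero>\<^bsub>\<A>\<^esub>" using shift_span_nil[OF bj(1)] by blast
    moreover have "b \<in> E_unital" using bj(1) shifts_span_E_unital by blast
    ultimately have "RE.right_invertible (\<one>\<^bsub>?RE\<^esub> \<ominus>\<^bsub>?RE\<^esub> (b \<oplus>\<^bsub>?RE\<^esub> j))"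
      using bj(2) by (intro RE.right_invertible_nil_plus_radical[of b N]) simp_all
    then obtain y where y: "y \<in> E_unital" "(\<one>\<^bsub>?RE\<^esub> \<ominus>\<^bsub>?RE\<^esub> x) \<otimes>\<^bsub>?RE\<^esub> y = \<one>\<^bsub>?RE\<^esub>"
      using bj(3) by (auto simp: RE.right_invertible_def)
    have yc: "y \<in> carrier \<A>" using y(1) E_unital_closed(1) by blast
    have xy: "x \<otimes>\<^bsub>\<A>\<^esub> y \<in> E" using x(1) y(1) by (rule E_right_ideal)
    have xyc: "x \<otimes>\<^bsub>\<A>\<^esub> y \<in> carrier \<A>" using x(3) yc by simp
    note minus = op.subalgebra_minus[OF E_unital_subalgebra] op.subalgebra_minus[OF E_subalgebra]
    have "(\<one>\<^bsub>\<A>\<^esub> \<ominus>\<^bsub>\<A>\<^esub> x) \<otimes>\<^bsub>\<A>\<^esub> y = \<one>\<^bsub>\<A>\<^esub>"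
      using y(2) x(2) by (simp add: a_minus_def minus)
    then have y1: "y \<oplus>\<^bsub>\<A>\<^esub> \<ominus>\<^bsub>\<A>\<^esub> (x \<otimes>\<^bsub>\<A>\<^esub> y) = \<one>\<^bsub>\<A>\<^esub>"
      using x(3) yc by (simp add: a_minus_def op.mult_add_left op.mult_minus)
    let ?z = "\<ominus>\<^bsub>\<A>\<^esub> (x \<otimes>\<^bsub>\<A>\<^esub> y)"
    have zE: "?z \<in> E" using xy by (rule minus(4))
    have "x = x \<otimes>\<^bsub>\<A>\<^esub> (y \<oplus>\<^bsub>\<A>\<^esub> ?z)" using x(3) by (simp add: y1)
    also have "\<dots> = x \<otimes>\<^bsub>\<A>\<^esub> y \<oplus>\<^bsub>\<A>\<^esub> x \<otimes>\<^bsub>\<A>\<^esub> ?z"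
      using x(3) yc xyc by (intro op.mult_add_right) simp_all
    finally have x_eq: "x = x \<otimes>\<^bsub>\<A>\<^esub> y \<oplus>\<^bsub>\<A>\<^esub> x \<otimes>\<^bsub>\<A>\<^esub> ?z" .
    have xz: "x \<otimes>\<^bsub>\<A>\<^esub> ?z \<in> E" "x \<otimes>\<^bsub>\<A>\<^esub> ?z \<in> carrier \<A>"
      using x(1) zE E_closed(1,5) by blast+
    have "x \<oplus>\<^bsub>\<A>\<^esub> ?z \<oplus>\<^bsub>\<A>\<^esub> \<ominus>\<^bsub>\<A>\<^esub> (x \<otimes>\<^bsub>\<A>\<^esub> ?z)
      = (x \<otimes>\<^bsub>\<A>\<^esub> y \<oplus>\<^bsub>\<A>\<^esub> x \<otimes>\<^bsub>\<A>\<^esub> ?z) \<oplus>\<^bsub>\<A>\<^esub> (?z \<oplus>\<^bsub>\<A>\<^esub> \<ominus>\<^bsub>\<A>\<^esub> (x \<otimes>\<^bsub>\<A>\<^esub> ?z))"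
      using x(3) xyc xz(2) by (subst x_eq[symmetric]) (simp add: op.M.a_assoc)
    also have "\<dots> = (x \<otimes>\<^bsub>\<A>\<^esub> y \<oplus>\<^bsub>\<A>\<^esub> ?z) \<oplus>\<^bsub>\<A>\<^esub> (x \<otimes>\<^bsub>\<A>\<^esub> ?z \<oplus>\<^bsub>\<A>\<^esub> \<ominus>\<^bsub>\<A>\<^esub> (x \<otimes>\<^bsub>\<A>\<^esub> ?z))"
      using xyc xz(2) by (simp only: op.M.a_ac op.M.a_inv_closed op.M.a_closed)
    also have "\<dots> = \<zero>\<^bsub>\<A>\<^esub>" using xyc xz(2) by (simp add: op.M.r_neg)
    finally show "\<exists>z\<in>carrier (\<A>\<lparr>carrier := E\<rparr>). x \<oplus>\<^bsub>\<A>\<lparr>carrier := E\<rparr>\<^esub> z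
        \<ominus>\<^bsub>\<A>\<lparr>carrier := E\<rparr>\<^esub> x \<otimes>\<^bsub>\<A>\<lparr>carrier := E\<rparr>\<^esub> z = \<zero>\<^bsub>\<A>\<lparr>carrier := E\<rparr>\<^esub>"
      using zE xz(1) by (intro bexI[of _ ?z]) (simp_all add: a_minus_def minus)
  qed
qed

end

section \<open>Embedding a radical algebra of countable dimension\<close>

lemma algebra_hom_comp:
  assumes "f \<in> algebra_hom F A B" "g \<in> algebra_hom F B C"
  shows "g \<circ> f \<in> algebra_hom F A C"
  using assms by (auto simp: algebra_hom_def LinearCombinations.module_hom_def hom_def Pi_iff)

lemma (in wreath) L_hom:
  assumes "f \<in> algebra_hom F A U" "f ` carrier A \<subseteq> I"
  shows "L \<circ> f \<in> algebra_hom F A (\<A>\<lparr>carrier := E\<rparr>)"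
proof -
  have fI: "f x \<in> I" if "x \<in> carrier A" for x using assms(2) that by blast
  then have fU: "f x \<in> carrier U" if "x \<in> carrier A" for x using that ideal_in_carrier by blast
  show ?thesis
    using assms(1) fI fU L_E L_add L_smult L_mult
    by (simp add: algebra_hom_def LinearCombinations.module_hom_def hom_def Pi_iff)
qed

lemma (in assoc_algebra) unitization_finsum:
  assumes "finite J" "c \<in> J \<rightarrow> carrier F" "a \<in> carrier A"
  shows "(\<Oplus>\<^bsub>unitization\<^esub>i\<in>J. (\<zero>\<^bsub>F\<^esub>, c i \<odot> a)) = (\<zero>\<^bsub>F\<^esub>, (\<Oplus>\<^bsub>F\<^esub>i\<in>J. c i) \<odot> a)"
proof -
  interpret U: assoc_algebra F unitization by (rule unitization_algebra)
  show ?thesis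
    using assms(1,2)
  proof (induction J rule: finite_induct)
    case empty
    show ?case using assms(3) by (simp add: U.M.finsum_empty) (simp add: unitization_def)
  next
    case (insert j J)
    have c: "c i \<in> carrier F" if "i \<in> insert j J" for i using insert.prems that by blast
    have "(\<lambda>i. (\<zero>\<^bsub>F\<^esub>, c i \<odot> a)) \<in> J \<rightarrow> carrier unitization"
      "(\<zero>\<^bsub>F\<^esub>, c j \<odot> a) \<in> carrier unitization"
      using c assms(3) by (auto simp: unitization_def)
    then have "(\<Oplus>\<^bsub>unitization\<^esub>i\<in>insert j J. (\<zero>\<^bsub>F\<^esub>, c i \<odot> a))
      = (\<zero>\<^bsub>F\<^esub>, c j \<odot> a) \<oplus>\<^bsub>unitization\<^esub> (\<zero>\<^bsub>F\<^esub>, (\<Oplus>\<^bsub>F\<^esub>i\<in>J. c i) \<odot> a)"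
      using insert by (simp add: U.M.finsum_insert)
    also have "\<dots> = (\<zero>\<^bsub>F\<^esub>, (c j \<oplus>\<^bsub>F\<^esub> (\<Oplus>\<^bsub>F\<^esub>i\<in>J. c i)) \<odot> a)"
      using c assms(3) by (simp add: unitization_def smult_l_distr R.finsum_closed)
    also have "c j \<oplus>\<^bsub>F\<^esub> (\<Oplus>\<^bsub>F\<^esub>i\<in>J. c i) = (\<Oplus>\<^bsub>F\<^esub>i\<in>insert j J. c i)"
      using insert.hyps c by (intro R.finsum_insert[symmetric]) auto
    finally show ?case .
  qed
qed

text \<open>
  In each positive degree \<open>n + 1\<close> there is a functional that annihilates the relations and takes the value 1
  at some word. Multiplied by the element with number \<open>n\<close> of a countable spanning set, these functionals
  together make up \<open>\<gamma>\<close>. It annihilates the relations because these are homogeneous.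
\<close>

lemma (in assoc_algebra) exists_wreath:
  assumes basis: "countable S" "S \<subseteq> carrier A" "span S = carrier A" and rad: "is_jacobson_radical A"
  shows "\<exists>\<gamma>. wreath F unitization ({\<zero>\<^bsub>F\<^esub>} \<times> carrier A) \<gamma>"
proof -
  interpret U: assoc_algebra F unitization by (rule unitization_algebra)
  let ?I = "{\<zero>\<^bsub>F\<^esub>} \<times> carrier A"
  have "\<forall>n. \<exists>\<psi>. \<psi> \<in> homogeneous n \<and> (\<exists>w. length w = n \<and> \<psi> w = \<one>\<^bsub>F\<^esub>)"
    using exists_homogeneous_functional by blast
  then obtain \<psi> where \<psi>: "\<And>n. \<psi> n \<in> homogeneous n"
    and \<psi>1: "\<And>n. \<exists>w. length w = n \<and> \<psi> n w = \<one>\<^bsub>F\<^esub>" by metis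
  have \<psi>c: "\<psi> n w \<in> carrier F" for n w using \<psi>[of n] by (auto simp: homogeneous_def)
  \<comment> \<open>The zero vector is added because the spanning set of the zero algebra may be empty.\<close>
  define f where "f = from_nat_into (insert \<zero> S)"
  have range_f: "range f = insert \<zero> S" unfolding f_def using basis(1) by (intro range_from_nat_into) auto
  have f: "f n \<in> carrier A" for n
  proof -
    have "f n \<in> insert \<zero> S" using range_f by (metis rangeI)
    then show ?thesis using basis(2) by auto
  qed
  define \<gamma> where "\<gamma> w = (\<zero>\<^bsub>F\<^esub>, \<psi> (length w) w \<odot> f (length w - 1))" for w :: "letter list"
  have \<gamma>I: "\<gamma> w \<in> ?I" for w using \<psi>c f by (simp add: \<gamma>_def)
  have "annihilates_relators unitization \<gamma>"
    unfolding annihilates_relators_def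
  proof (intro allI ballI)
    fix D m and u v :: "letter list" assume m: "m \<in> relators D"
    define n where "n = length u + weight m + length v"
    have "annihilates_relators F (\<psi> n)" using \<psi>[of n] by (simp add: homogeneous_def)
    then have zero: "(\<Oplus>\<^bsub>F\<^esub>us\<in>{us. mset us = m}. \<psi> n (u @ concat us @ v)) = \<zero>\<^bsub>F\<^esub>"
      using m unfolding annihilates_relators_def by blast
    have *: "\<gamma> (u @ concat us @ v) = (\<zero>\<^bsub>F\<^esub>, \<psi> n (u @ concat us @ v) \<odot> f (n - 1))"
      if "us \<in> {us. mset us = m}" for us
    proof -
      have "length (u @ concat us @ v) = n"
        using that length_concat_eq_weight[of us m] by (simp add: n_def)
      then show ?thesis unfolding \<gamma>_def by (simp only:)
    qed
    have "(\<Oplus>\<^bsub>unitization\<^esub>us\<in>{us. mset us = m}. \<gamma> (u @ concat us @ v))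
      = (\<Oplus>\<^bsub>unitization\<^esub>us\<in>{us. mset us = m}. (\<zero>\<^bsub>F\<^esub>, \<psi> n (u @ concat us @ v) \<odot> f (n - 1)))"
      using \<psi>c f by (intro U.M.finsum_cong' *) (auto simp: unitization_def)
    also have "\<dots> = (\<zero>\<^bsub>F\<^esub>, (\<Oplus>\<^bsub>F\<^esub>us\<in>{us. mset us = m}. \<psi> n (u @ concat us @ v)) \<odot> f (n - 1))"
      using \<psi>c f by (intro unitization_finsum) auto
    also have "\<dots> = \<zero>\<^bsub>unitization\<^esub>" unfolding zero using f by (simp add: unitization_def)
    finally show "(\<Oplus>\<^bsub>unitization\<^esub>us\<in>{us. mset us = m}. \<gamma> (u @ concat us @ v)) = \<zero>\<^bsub>unitization\<^esub>" .
  qed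
  moreover have "?I \<subseteq> U.span (\<gamma> ` {w. w \<noteq> []})"
  proof -
    let ?G = "\<gamma> ` {w. w \<noteq> []}"
    have "?I \<subseteq> carrier unitization" by (auto simp: unitization_def)
    then have G: "?G \<subseteq> carrier unitization" using \<gamma>I by blast
    have sub: "submodule F (U.span ?G) unitization" using G by (rule U.span_is_submodule)
    have SG: "(\<zero>\<^bsub>F\<^esub>, s) \<in> U.span ?G" if s: "s \<in> S" for s
    proof -
      obtain n where n: "f n = s" using s range_f by (metis insertI2 rangeE)
      obtain w where w: "length w = Suc n" "\<psi> (Suc n) w = \<one>\<^bsub>F\<^esub>" using \<psi>1 by blast
      have "w \<noteq> []" using w(1) by auto
      moreover have "\<gamma> w = (\<zero>\<^bsub>F\<^esub>, s)" using w n s basis(2) by (auto simp: \<gamma>_def)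
      ultimately have "(\<zero>\<^bsub>F\<^esub>, s) \<in> ?G" by (metis (mono_tags, lifting) image_eqI mem_Collect_eq)
      then show ?thesis using U.in_own_span[OF G] by blast
    qed
    have "submodule F {x \<in> carrier A. (\<zero>\<^bsub>F\<^esub>, x) \<in> U.span ?G} A"
    proof (rule submodule_criterion)
      show "\<zero> \<in> {x \<in> carrier A. (\<zero>\<^bsub>F\<^esub>, x) \<in> U.span ?G}"
        using submodule.zero_closed[OF sub] by (simp add: unitization_def)
      show "x \<oplus> y \<in> {x \<in> carrier A. (\<zero>\<^bsub>F\<^esub>, x) \<in> U.span ?G}"
        if "x \<in> {x \<in> carrier A. (\<zero>\<^bsub>F\<^esub>, x) \<in> U.span ?G}" "y \<in> {x \<in> carrier A. (\<zero>\<^bsub>F\<^esub>, x) \<in> U.span ?G}"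
        for x y
        using that submodule.m_closed[OF sub, of "(\<zero>\<^bsub>F\<^esub>, x)" "(\<zero>\<^bsub>F\<^esub>, y)"]
        by (auto simp: unitization_def)
      show "c \<odot> x \<in> {x \<in> carrier A. (\<zero>\<^bsub>F\<^esub>, x) \<in> U.span ?G}"
        if "c \<in> carrier F" "x \<in> {x \<in> carrier A. (\<zero>\<^bsub>F\<^esub>, x) \<in> U.span ?G}" for c x
        using that submodule.smult_closed[OF sub, of c "(\<zero>\<^bsub>F\<^esub>, x)"]
        by (auto simp: unitization_def)
    qed auto
    then have "span S \<subseteq> {x \<in> carrier A. (\<zero>\<^bsub>F\<^esub>, x) \<in> U.span ?G}"
      using SG basis(2) by (intro span_is_subset) auto
    then show ?thesis using basis(3) by auto
  qed
  moreover have "\<exists>y\<in>?I. x \<oplus>\<^bsub>unitization\<^esub> y \<ominus>\<^bsub>unitization\<^esub> x \<otimes>\<^bsub>unitization\<^esub> y = \<zero>\<^bsub>unitization\<^esub>"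
    if "x \<in> ?I" for x
  proof -
    from that obtain a where a: "a \<in> carrier A" "x = (\<zero>\<^bsub>F\<^esub>, a)" by auto
    obtain b where b: "b \<in> carrier A" "a \<oplus> b \<ominus> a \<otimes> b = \<zero>"
      using right_quasi_regular[OF rad a(1)] by blast
    have minus: "\<ominus>\<^bsub>unitization\<^esub> (\<zero>\<^bsub>F\<^esub>, c) = (\<zero>\<^bsub>F\<^esub>, \<ominus> c)" if "c \<in> carrier A" for c
      using that by (intro U.M.minus_equality) (auto simp: unitization_def M.l_neg)
    have prod: "x \<otimes>\<^bsub>unitization\<^esub> (\<zero>\<^bsub>F\<^esub>, b) = (\<zero>\<^bsub>F\<^esub>, a \<otimes> b)"
      using a b(1) by (simp add: unitization_def mult_closed)
    have sum: "x \<oplus>\<^bsub>unitization\<^esub> (\<zero>\<^bsub>F\<^esub>, b) = (\<zero>\<^bsub>F\<^esub>, a \<oplus> b)"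
      using a b(1) by (simp add: unitization_def)
    have "(\<zero>\<^bsub>F\<^esub>, a \<oplus> b) \<oplus>\<^bsub>unitization\<^esub> (\<zero>\<^bsub>F\<^esub>, \<ominus> (a \<otimes> b)) = \<zero>\<^bsub>unitization\<^esub>"
      using b(2) by (simp add: unitization_def a_minus_def)
    then have "x \<oplus>\<^bsub>unitization\<^esub> (\<zero>\<^bsub>F\<^esub>, b) \<ominus>\<^bsub>unitization\<^esub> x \<otimes>\<^bsub>unitization\<^esub> (\<zero>\<^bsub>F\<^esub>, b)
        = \<zero>\<^bsub>unitization\<^esub>"
      unfolding prod sum using minus[of "a \<otimes> b"] a(1) b(1) by (simp add: a_minus_def mult_closed)
    then show ?thesis using b(1) by blast
  qed
  moreover have "?I \<subseteq> carrier unitization" "\<zero>\<^bsub>unitization\<^esub> \<in> ?I"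
    by (auto simp: unitization_def)
  moreover have "x \<oplus>\<^bsub>unitization\<^esub> y \<in> ?I" if "x \<in> ?I" "y \<in> ?I" for x y
    using that by (auto simp: unitization_def)
  ultimately have "wreath_axioms F unitization ?I \<gamma>"
    using \<gamma>I unitization_ideal unitization_simps by unfold_locales
  then show ?thesis
    using unitization_algebra unfolding wreath_def by blast
qed

theorem theorem4p1:
  fixes F :: "('f, 'm) ring_scheme"
    and A :: "('f, 'a, 'n) module_scheme"
  assumes "field F"
    and "assoc_algebra F A"
    and "countable_dimensional F A"
    and "is_jacobson_radical A"
  shows "\<exists>(B :: ('f, nat \<Rightarrow> 'f) module) h.
    assoc_algebra F B \<and> finitely_generated_algebra F B \<and> is_jacobson_radical B \<and>
    h \<in> algebra_hom F A B \<and> inj_on h (carrier A)"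
proof -
  interpret A: assoc_algebra F A by fact
  obtain S where "countable S" "A.basis S"
    using assms(3) by (auto simp: countable_dimensional_def)
  then have S: "countable S" "S \<subseteq> carrier A" "A.span S = carrier A"
    by (auto simp: A.basis_def)
  obtain \<gamma> where "wreath F A.unitization ({\<zero>\<^bsub>F\<^esub>} \<times> carrier A) \<gamma>"
    using A.exists_wreath[OF S assms(4)] by blast
  then interpret W: wreath F A.unitization "{\<zero>\<^bsub>F\<^esub>} \<times> carrier A" \<gamma> .
  let ?E = "W.op_algebra\<lparr>carrier := W.E\<rparr>"
  interpret E: assoc_algebra F ?E by (rule W.E_algebra)
  obtain B :: "('f, nat \<Rightarrow> 'f) module" and \<theta> where
    B: "assoc_algebra F B" "finitely_generated_algebra F B" "is_jacobson_radical B"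
    and \<theta>: "\<theta> \<in> algebra_hom F ?E B" "inj_on \<theta> (carrier ?E)"
    using E.finitely_generated_on_sequences[OF W.E_finitely_generated W.E_radical] by blast
  let ?g = "W.L \<circ> Pair \<zero>\<^bsub>F\<^esub>"
  have g: "?g \<in> algebra_hom F A ?E"
    by (rule W.L_hom[OF A.unitization_embedding]) auto
  have inj: "inj_on ?g (carrier A)"
    using inj_on_subset[OF W.L_inj W.ideal_carrier] by (intro comp_inj_on) (auto simp: inj_on_def)
  have "?g ` carrier A \<subseteq> carrier ?E"
    using g by (auto simp: algebra_hom_def hom_def Pi_iff)
  then have "inj_on (\<theta> \<circ> ?g) (carrier A)"
    using comp_inj_on[OF inj inj_on_subset[OF \<theta>(2)]] by blast
  moreover have "\<theta> \<circ> ?g \<in> algebra_hom F A B" using g \<theta>(1) by (rule algebra_hom_comp)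
  ultimately show ?thesis using B by blast
qed

end
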